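(* Let $\mathcal V$ be a congruence modular variety, $\mathbb A\in\mathcal V$, $n\ge 2$ and $\theta_0,\dots,\theta_{n-1}\in\mathrm{Con}(\mathbb A)$. Then $$[\theta_0,\dots,\theta_{n-1}]_{TC}=[\theta_0,\dots,\theta_{n-1}]_{H}.$$
   Context: Cube notation. Each $n\in\mathbb N$ is identified with $\{0,\dots,n-1\}$ and $2=\{0,1\}$. For a finite $S\subseteq\mathbb N$, $2^S$ is the set of functions $S\to 2$; $\mathbf 0,\mathbf 1\in 2^S$ are the constant functions. For a set $A$, an element $\gamma=(\gamma_f)_{f\in 2^S}\in A^{2^S}$ is an $(S)$-cube (an $(n)$-cube if $S=n$). For $i\in S$, $j\in 2$, the face $\mathrm{face}_i^j(\gamma)\in A^{2^{S\setminus\{i\}}}$ is $g\mapsto \gamma_{g\cup\{(i,j)\}}$. For $i\in S$ and $\zeta,\eta\in A^{2^{S\setminus\{i\}}}$, $\mathrm{glue}_{\{i\}}(\zeta,\eta)$ is the unique $\gamma$ with $\mathrm{face}_i^0(\gamma)=\zeta$, $\mathrm{face}_i^1(\gamma)=\eta$. For $R\subseteq A^{2^S}$, $\mathrm{face}_i(R)=\{(\mathrm{face}_i^0(\gamma),\mathrm{face}_i^1(\gamma)):\gamma\in R\}$. Further $\mathrm{refl}_i^j(\gamma)=\mathrm{glue}_{\{i\}}(\mathrm{face}_i^j\gamma,\mathrm{face}_i^j\gamma)$ and $\mathrm{sym}_i(\gamma)=\mathrm{glue}_{\{i\}}(\mathrm{face}_i^1\gamma,\mathrm{face}_i^0\gamma)$.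 For $x,y\in A$, $i\in S$, $\mathrm{cube}_i(x,y)\in A^{2^S}$ takes value $x$ at all $f$ with $f(i)=0$ and $y$ at all $f$ with $f(i)=1$. Lines. For $\gamma\in A^{2^S}$, $i\in S$, $f\in 2^{S\setminus\{i\}}$, the $(i)$-cross-section line of $\gamma$ at $f$ is the pair $(\gamma_{f\cup\{(i,0)\}},\gamma_{f\cup\{(i,1)\}})$; for $f=\mathbf 1$ it is the $(i)$-pivot line, and for $f\neq\mathbf 1$ it is an $(i)$-supporting line. For a congruence $\delta$, a $\delta$-pair is a pair in $\delta$. Higher dimensional relations. Let $\mathbb A$ be an algebra and $|S|=n\ge1$. A subuniverse $R$ of $\mathbb A^{2^S}$ is an $(n)$-dimensional tolerance of $\mathbb A$ if $\mathrm{refl}_i^j(\gamma),\mathrm{sym}_i(\gamma)\in R$ for all $\gamma\in R$, $i\in S$, $j\in 2$; it is an $(n)$-dimensional congruence if moreover $\mathrm{face}_i(R)$ is transitive for every $i\in S$. Centrality. For $\delta\in\mathrm{Con}(\mathbb A)$ and $i\in S$, $R\subseteq A^{2^S}$ has $(\delta,i)$-centrality if for every $\gamma\in R$ all of whose $(i)$-supporting lines are $\delta$-pairs, the $(i)$-pivot line of $\gamma$ is a $\delta$-pair; $R$ has $\delta$-centrality if it has $(\delta,i)$-centrality for all $i\in S$. Commutators. For $\theta_k\in\mathrm{Con}(\mathbb A)$ ($k\in S$), $M(\{\theta_k\}_{k\in S})$ is the subuniverse of $\mathbb A^{2^S}$ generated by all $\mathrm{cube}_k(x,y)$ with $k\in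 S$, $(x,y)\in\theta_k$, and $\Delta(\{\theta_k\}_{k\in S})$ is the smallest $(|S|)$-dimensional congruence of $\mathbb A$ containing $M(\{\theta_k\}_{k\in S})$; for $S=n$ write $M(\theta_0,\dots,\theta_{n-1})$, $\Delta(\theta_0,\dots,\theta_{n-1})$. For $n\ge2$, the term condition commutator $[\theta_0,\dots,\theta_{n-1}]_{TC}$ is the least $\delta\in\mathrm{Con}(\mathbb A)$ such that $M(\theta_0,\dots,\theta_{n-1})$ has $\delta$-centrality, and the hypercommutator $[\theta_0,\dots,\theta_{n-1}]_{H}$ is the least $\delta\in\mathrm{Con}(\mathbb A)$ such that $\Delta(\theta_0,\dots,\theta_{n-1})$ has $\delta$-centrality. *)

theory Defs
  imports "HOL-Library.FuncSet"
begin

definition algebra :: "('f \<Rightarrow> nat) \<Rightarrow> 'a set \<Rightarrow> ('f \<Rightarrow> 'a list \<Rightarrow> 'a) \<Rightarrow> bool" where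
  "algebra ar A F \<longleftrightarrow> A \<noteq> {} \<and>
     (\<forall>f xs. length xs = ar f \<and> set xs \<subseteq> A \<longrightarrow> F f xs \<in> A)"

datatype ('f, 'v) trm = Var 'v | Fn 'f "('f, 'v) trm list"

fun wf_trm :: "('f \<Rightarrow> nat) \<Rightarrow> ('f, 'v) trm \<Rightarrow> bool" where
  "wf_trm ar (Var v) = True"
| "wf_trm ar (Fn f ts) = (length ts = ar f \<and> (\<forall>t\<in>set ts. wf_trm ar t))"

fun eval_trm :: "('f \<Rightarrow> 'a list \<Rightarrow> 'a) \<Rightarrow> ('v \<Rightarrow> 'a) \<Rightarrow> ('f, 'v) trm \<Rightarrow> 'a" where
  "eval_trm F env (Var v) = env v"
| "eval_trm F env (Fn f ts) = F f (map (eval_trm F env) ts)"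

definition satisfies_id ::
  "'a set \<Rightarrow> ('f \<Rightarrow> 'a list \<Rightarrow> 'a) \<Rightarrow> ('f, nat) trm \<Rightarrow> ('f, nat) trm \<Rightarrow> bool" where
  "satisfies_id A F s t \<longleftrightarrow>
     (\<forall>env. (\<forall>v. env v \<in> A) \<longrightarrow> eval_trm F env s = eval_trm F env t)"

definition identities ::
  "('f \<Rightarrow> nat) \<Rightarrow> 'a set \<Rightarrow> ('f \<Rightarrow> 'a list \<Rightarrow> 'a) \<Rightarrow> (('f, nat) trm \<times> ('f, nat) trm) set" where
  "identities ar A F = {(s, t). wf_trm ar s \<and> wf_trm ar t \<and> satisfies_id A F s t}"

text \<open>B belongs to the variety V(A) = HSP(A) generated by A (Birkhoff: the class of
 algebras satisfying all identities of A).\<close>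
definition in_variety_of ::
  "('f \<Rightarrow> nat) \<Rightarrow> 'a set \<Rightarrow> ('f \<Rightarrow> 'a list \<Rightarrow> 'a) \<Rightarrow> 'b set \<Rightarrow> ('f \<Rightarrow> 'b list \<Rightarrow> 'b) \<Rightarrow> bool" where
  "in_variety_of ar A F B G \<longleftrightarrow> algebra ar B G \<and>
     (\<forall>(s, t) \<in> identities ar A F. satisfies_id B G s t)"

definition compatible :: "('f \<Rightarrow> nat) \<Rightarrow> 'a set \<Rightarrow> ('f \<Rightarrow> 'a list \<Rightarrow> 'a) \<Rightarrow> 'a rel \<Rightarrow> bool" where
  "compatible ar A F \<theta> \<longleftrightarrow>
     (\<forall>f xs ys. length xs = ar f \<and> length ys = ar f \<and> set xs \<subseteq> A \<and> set ys \<subseteq> A \<and>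
        list_all2 (\<lambda>x y. (x, y) \<in> \<theta>) xs ys \<longrightarrow> (F f xs, F f ys) \<in> \<theta>)"

definition Con :: "('f \<Rightarrow> nat) \<Rightarrow> 'a set \<Rightarrow> ('f \<Rightarrow> 'a list \<Rightarrow> 'a) \<Rightarrow> 'a rel set" where
  "Con ar A F = {\<theta>. equiv A \<theta> \<and> compatible ar A F \<theta>}"

definition con_join ::
  "('f \<Rightarrow> nat) \<Rightarrow> 'a set \<Rightarrow> ('f \<Rightarrow> 'a list \<Rightarrow> 'a) \<Rightarrow> 'a rel \<Rightarrow> 'a rel \<Rightarrow> 'a rel" where
  "con_join ar A F \<alpha> \<beta> = \<Inter>{\<theta> \<in> Con ar A F. \<alpha> \<union> \<beta> \<subseteq> \<theta>}"

definition con_modular :: "('f \<Rightarrow> nat) \<Rightarrow> 'a set \<Rightarrow> ('f \<Rightarrow> 'a list \<Rightarrow> 'a) \<Rightarrow> bool" where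
  "con_modular ar A F \<longleftrightarrow>
     (\<forall>\<alpha>\<in>Con ar A F. \<forall>\<beta>\<in>Con ar A F. \<forall>\<gamma>\<in>Con ar A F. \<alpha> \<subseteq> \<gamma> \<longrightarrow>
        con_join ar A F \<alpha> \<beta> \<inter> \<gamma> = con_join ar A F \<alpha> (\<beta> \<inter> \<gamma>))"

text \<open>A lies in a congruence modular variety iff the variety V(A) generated by A
 is congruence modular.  Since HOL cannot quantify over types inside a formula,
 we quantify over all algebras in V(A) whose carrier lies in the type
 ('a + 'f) list, which has cardinality max(|A|,|signature|,aleph0); by the
 downward Loewenheim-Skolem theorem any failure of congruence modularity in V(A)
 is witnessed by an algebra of that size, so this is equivalent.\<close>
definition in_CM_variety :: "('f \<Rightarrow> nat) \<Rightarrow> 'a set \<Rightarrow> ('f \<Rightarrow> 'a list \<Rightarrow> 'a) \<Rightarrow> bool" where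
  "in_CM_variety ar A F \<longleftrightarrow>
     (\<forall>(B :: ('a + 'f) list set) G. in_variety_of ar A F B G \<longrightarrow> con_modular ar B G)"

text \<open>An element f of 2^S is represented by the subset {i \<in> S. f i = 1};
 an (S)-cube over A is an extensional function on Pow S with values in A.\<close>

definition cubes :: "nat set \<Rightarrow> 'a set \<Rightarrow> (nat set \<Rightarrow> 'a) set" where
  "cubes S A = (Pow S \<rightarrow>\<^sub>E A)"

definition face :: "nat set \<Rightarrow> nat \<Rightarrow> bool \<Rightarrow> (nat set \<Rightarrow> 'a) \<Rightarrow> (nat set \<Rightarrow> 'a)" where
  "face S i j \<gamma> = (\<lambda>u\<in>Pow (S - {i}). \<gamma> (if j then insert i u else u))"

definition glue :: "nat set \<Rightarrow> nat \<Rightarrow> (nat set \<Rightarrow> 'a) \<Rightarrow> (nat set \<Rightarrow> 'a) \<Rightarrow> (nat set \<Rightarrow> 'a)" where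
  "glue S i \<zeta> \<eta> = (\<lambda>u\<in>Pow S. if i \<in> u then \<eta> (u - {i}) else \<zeta> u)"

definition refl_cube :: "nat set \<Rightarrow> nat \<Rightarrow> bool \<Rightarrow> (nat set \<Rightarrow> 'a) \<Rightarrow> (nat set \<Rightarrow> 'a)" where
  "refl_cube S i j \<gamma> = glue S i (face S i j \<gamma>) (face S i j \<gamma>)"

definition sym_cube :: "nat set \<Rightarrow> nat \<Rightarrow> (nat set \<Rightarrow> 'a) \<Rightarrow> (nat set \<Rightarrow> 'a)" where
  "sym_cube S i \<gamma> = glue S i (face S i True \<gamma>) (face S i False \<gamma>)"

definition face_rel :: "nat set \<Rightarrow> nat \<Rightarrow> (nat set \<Rightarrow> 'a) set \<Rightarrow> ((nat set \<Rightarrow> 'a) \<times> (nat set \<Rightarrow> 'a)) set" where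
  "face_rel S i R = {(face S i False \<gamma>, face S i True \<gamma>) | \<gamma>. \<gamma> \<in> R}"

definition cube_k :: "nat set \<Rightarrow> nat \<Rightarrow> 'a \<Rightarrow> 'a \<Rightarrow> (nat set \<Rightarrow> 'a)" where
  "cube_k S k x y = (\<lambda>u\<in>Pow S. if k \<in> u then y else x)"

definition cube_subuniverse ::
  "('f \<Rightarrow> nat) \<Rightarrow> 'a set \<Rightarrow> ('f \<Rightarrow> 'a list \<Rightarrow> 'a) \<Rightarrow> nat set \<Rightarrow> (nat set \<Rightarrow> 'a) set \<Rightarrow> bool" where
  "cube_subuniverse ar A F S R \<longleftrightarrow> R \<subseteq> cubes S A \<and>
     (\<forall>f \<gamma>s. length \<gamma>s = ar f \<and> set \<gamma>s \<subseteq> R \<longrightarrow>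
        (\<lambda>u\<in>Pow S. F f (map (\<lambda>\<gamma>. \<gamma> u) \<gamma>s)) \<in> R)"

definition hd_tolerance ::
  "('f \<Rightarrow> nat) \<Rightarrow> 'a set \<Rightarrow> ('f \<Rightarrow> 'a list \<Rightarrow> 'a) \<Rightarrow> nat set \<Rightarrow> (nat set \<Rightarrow> 'a) set \<Rightarrow> bool" where
  "hd_tolerance ar A F S R \<longleftrightarrow> cube_subuniverse ar A F S R \<and>
     (\<forall>\<gamma>\<in>R. \<forall>i\<in>S. (\<forall>j. refl_cube S i j \<gamma> \<in> R) \<and> sym_cube S i \<gamma> \<in> R)"

definition hd_congruence ::
  "('f \<Rightarrow> nat) \<Rightarrow> 'a set \<Rightarrow> ('f \<Rightarrow> 'a list \<Rightarrow> 'a) \<Rightarrow> nat set \<Rightarrow> (nat set \<Rightarrow> 'a) set \<Rightarrow> bool" where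
  "hd_congruence ar A F S R \<longleftrightarrow> hd_tolerance ar A F S R \<and>
     (\<forall>i\<in>S. trans (face_rel S i R))"

definition M_rel ::
  "('f \<Rightarrow> nat) \<Rightarrow> 'a set \<Rightarrow> ('f \<Rightarrow> 'a list \<Rightarrow> 'a) \<Rightarrow> nat set \<Rightarrow> (nat \<Rightarrow> 'a rel) \<Rightarrow> (nat set \<Rightarrow> 'a) set" where
  "M_rel ar A F S \<theta> = \<Inter>{R. cube_subuniverse ar A F S R \<and>
      (\<forall>k\<in>S. \<forall>(x, y)\<in>\<theta> k. cube_k S k x y \<in> R)}"

definition Delta_rel ::
  "('f \<Rightarrow> nat) \<Rightarrow> 'a set \<Rightarrow> ('f \<Rightarrow> 'a list \<Rightarrow> 'a) \<Rightarrow> nat set \<Rightarrow> (nat \<Rightarrow> 'a rel) \<Rightarrow> (nat set \<Rightarrow> 'a) set" where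
  "Delta_rel ar A F S \<theta> = \<Inter>{R. hd_congruence ar A F S R \<and> M_rel ar A F S \<theta> \<subseteq> R}"

text \<open>(delta,i)-centrality: supporting lines are cross-section lines at u \<noteq> S-{i}
 (u \<subseteq> S-{i} encodes f); the pivot line is the one at u = S-{i} (f = 1).\<close>
definition central_at :: "nat set \<Rightarrow> 'a rel \<Rightarrow> nat \<Rightarrow> (nat set \<Rightarrow> 'a) set \<Rightarrow> bool" where
  "central_at S \<delta> i R \<longleftrightarrow>
     (\<forall>\<gamma>\<in>R. (\<forall>u. u \<subseteq> S - {i} \<and> u \<noteq> S - {i} \<longrightarrow> (\<gamma> u, \<gamma> (insert i u)) \<in> \<delta>)
        \<longrightarrow> (\<gamma> (S - {i}), \<gamma> S) \<in> \<delta>)"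

definition central :: "nat set \<Rightarrow> 'a rel \<Rightarrow> (nat set \<Rightarrow> 'a) set \<Rightarrow> bool" where
  "central S \<delta> R \<longleftrightarrow> (\<forall>i\<in>S. central_at S \<delta> i R)"

text \<open>Least congruence with the centrality property (centrality is preserved
 under intersections, and A x A always has it, so the intersection is the least one).\<close>
definition TC_comm ::
  "('f \<Rightarrow> nat) \<Rightarrow> 'a set \<Rightarrow> ('f \<Rightarrow> 'a list \<Rightarrow> 'a) \<Rightarrow> nat \<Rightarrow> (nat \<Rightarrow> 'a rel) \<Rightarrow> 'a rel" where
  "TC_comm ar A F n \<theta> =
     \<Inter>{\<delta> \<in> Con ar A F. central {..<n} \<delta> (M_rel ar A F {..<n} \<theta>)}"

definition H_comm ::
  "('f \<Rightarrow> nat) \<Rightarrow> 'a set \<Rightarrow> ('f \<Rightarrow> 'a list \<Rightarrow> 'a) \<Rightarrow> nat \<Rightarrow> (nat \<Rightarrow> 'a rel) \<Rightarrow> 'a rel" where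
  "H_comm ar A F n \<theta> =
     \<Inter>{\<delta> \<in> Con ar A F. central {..<n} \<delta> (Delta_rel ar A F {..<n} \<theta>)}"

end

theory Submission
  imports Defs
begin

text \<open>
  Fix a congruence \<open>\<delta>\<close>; the point is that \<open>\<delta>\<close>-centrality passes from \<open>M\<close> to \<open>\<Delta>\<close>.  Modularity
  of a free algebra yields terms \<open>t\<close> with \<open>t(x, y, y, x) = x\<close> (Day terms) that detect \<open>\<delta>\<close>: if
  \<open>(b, d) \<in> \<delta>\<close> and \<open>t(a, b, d, c)\<close>, \<open>t(a, a, c, c)\<close> are \<open>\<delta>\<close>-related for all of them, then
  \<open>(a, c) \<in> \<delta>\<close>.  Applied to a cube and its degeneracies, a Day term moves a question about lines
  in direction \<open>i\<close> to one about lines in direction \<open>j\<close>.  Hence for a higher dimensional tolerance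
  centrality in one direction implies centrality in all, and centrality survives composing cubes
  in a direction \<open>k\<close>, because the question can be moved through all directions other than \<open>k\<close>
  until only the pivot lines of the two composed cubes are in doubt.  A maximal \<open>\<delta>\<close>-central
  tolerance above \<open>M\<close> is therefore closed under composition, i.e. a higher dimensional congruence,
  and contains \<open>\<Delta>\<close>.
\<close>

subsection \<open>Congruences, term operations and homomorphisms\<close>

lemma Con_subset: "\<theta> \<in> Con ar A F \<Longrightarrow> \<theta> \<subseteq> A \<times> A"
  and Con_refl: "\<theta> \<in> Con ar A F \<Longrightarrow> x \<in> A \<Longrightarrow> (x, x) \<in> \<theta>"
  and Con_sym: "\<theta> \<in> Con ar A F \<Longrightarrow> (x, y) \<in> \<theta> \<Longrightarrow> (y, x) \<in> \<theta>"
  and Con_trans: "\<theta> \<in> Con ar A F \<Longrightarrow> (x, y) \<in> \<theta> \<Longrightarrow> (y, z) \<in> \<theta> \<Longrightarrow> (x, z) \<in> \<theta>"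
  unfolding Con_def equiv_def refl_on_def sym_def trans_def by blast+

lemma Con_compatible:
  assumes \<theta>: "\<theta> \<in> Con ar A F" and "length xs = ar f" and xys: "(xs, ys) \<in> listrel \<theta>"
  shows "(F f xs, F f ys) \<in> \<theta>"
proof -
  have "set xs \<subseteq> A" "set ys \<subseteq> A"
    using xys Con_subset[OF \<theta>] by (fastforce simp: listrel_iff_nth in_set_conv_nth)+
  moreover have "list_all2 (\<lambda>x y. (x, y) \<in> \<theta>) xs ys"
    using xys by (simp add: listrel_iff_nth list_all2_conv_all_nth)
  moreover have "length ys = ar f" using xys \<open>length xs = ar f\<close> by (simp add: listrel_iff_nth)
  ultimately show ?thesis
    using \<theta> \<open>length xs = ar f\<close> unfolding Con_def compatible_def by simp
qed

lemma algebra_closed: "algebra ar A F \<Longrightarrow> length xs = ar f \<Longrightarrow> set xs \<subseteq> A \<Longrightarrow> F f xs \<in> A"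
  by (simp add: algebra_def)

lemma eval_trm_closed:
  assumes alg: "algebra ar A F" and "wf_trm ar t" and e: "\<And>v. e v \<in> A"
  shows "eval_trm F e t \<in> A"
  using \<open>wf_trm ar t\<close>
proof (induction t)
  case (Fn f ts)
  then show ?case by (auto intro!: algebra_closed[OF alg])
qed (simp add: e)

lemma eval_trm_Con:
  assumes \<theta>: "\<theta> \<in> Con ar A F" and "wf_trm ar t" and e: "\<And>v. (e v, e' v) \<in> \<theta>"
  shows "(eval_trm F e t, eval_trm F e' t) \<in> \<theta>"
  using \<open>wf_trm ar t\<close>
proof (induction t)
  case (Fn f ts)
  then show ?case by (auto intro!: Con_compatible[OF \<theta>] simp: listrel_iff_nth)
qed (simp add: e)

definition alg_hom ::
  "('f \<Rightarrow> nat) \<Rightarrow> 'a set \<Rightarrow> ('f \<Rightarrow> 'a list \<Rightarrow> 'a) \<Rightarrow> 'b set \<Rightarrow> ('f \<Rightarrow> 'b list \<Rightarrow> 'b) \<Rightarrow> ('a \<Rightarrow> 'b) \<Rightarrow> bool"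
  where
  "alg_hom ar A F B G h \<longleftrightarrow> h ` A \<subseteq> B \<and>
     (\<forall>f xs. length xs = ar f \<and> set xs \<subseteq> A \<longrightarrow> h (F f xs) = G f (map h xs))"

lemma alg_hom_eval_trm:
  assumes alg: "algebra ar A F" and h: "alg_hom ar A F B G h"
    and "wf_trm ar t" and e: "\<And>v. e v \<in> A"
  shows "h (eval_trm F e t) = eval_trm G (\<lambda>v. h (e v)) t"
  using \<open>wf_trm ar t\<close>
proof (induction t)
  case (Fn f ts)
  then have "set (map (eval_trm F e) ts) \<subseteq> A" by (auto intro!: eval_trm_closed[OF alg] e)
  then have "h (F f (map (eval_trm F e) ts)) = G f (map h (map (eval_trm F e) ts))"
    using h Fn.prems unfolding alg_hom_def by (metis length_map wf_trm.simps(2))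
  also have "map h (map (eval_trm F e) ts) = map (eval_trm G (\<lambda>v. h (e v))) ts"
    using Fn by simp
  finally show ?case by simp
qed simp

lemma in_variety_of_separated:
  assumes alg: "algebra ar B G"
    and separated: "\<And>p q. p \<in> B \<Longrightarrow> q \<in> B \<Longrightarrow>
      (\<And>h. alg_hom ar B G A F h \<Longrightarrow> h p = h q) \<Longrightarrow> p = q"
  shows "in_variety_of ar A F B G"
  unfolding in_variety_of_def
proof (intro conjI alg ballI, clarify)
  fix s t assume "(s, t) \<in> identities ar A F"
  then have wf: "wf_trm ar s" "wf_trm ar t" and st: "satisfies_id A F s t"
    by (auto simp: identities_def)
  have "eval_trm G e s = eval_trm G e t" if e: "\<And>v. e v \<in> B" for e
  proof (rule separated)
    show "eval_trm G e s \<in> B" "eval_trm G e t \<in> B" by (intro eval_trm_closed[OF alg] wf e)+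
    fix h assume h: "alg_hom ar B G A F h"
    have "h (e v) \<in> A" for v using h e[of v] by (auto simp: alg_hom_def)
    then show "h (eval_trm G e s) = h (eval_trm G e t)"
      using st by (simp add: alg_hom_eval_trm[OF alg h _ e] wf satisfies_id_def)
  qed
  then show "satisfies_id B G s t" by (simp add: satisfies_id_def)
qed

definition hom_kernel :: "'b set \<Rightarrow> ('b \<Rightarrow> 'a) set \<Rightarrow> 'b rel" where
  "hom_kernel B H = {(p, q). p \<in> B \<and> q \<in> B \<and> (\<forall>h\<in>H. h p = h q)}"

lemma hom_kernel_Con:
  assumes alg: "algebra ar B G" and H: "\<And>h. h \<in> H \<Longrightarrow> alg_hom ar B G A F h"
  shows "hom_kernel B H \<in> Con ar B G"
proof -
  have "equiv B (hom_kernel B H)"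
    by (auto simp: hom_kernel_def equiv_def refl_on_def sym_def trans_def)
  moreover have "compatible ar B G (hom_kernel B H)"
    unfolding compatible_def
  proof (intro allI impI)
    fix f xs ys
    assume xys: "length xs = ar f \<and> length ys = ar f \<and> set xs \<subseteq> B \<and> set ys \<subseteq> B \<and>
      list_all2 (\<lambda>x y. (x, y) \<in> hom_kernel B H) xs ys"
    have "h (G f xs) = h (G f ys)" if "h \<in> H" for h
    proof -
      have "map h xs = map h ys"
        using xys that by (auto simp: list_eq_iff_nth_eq list_all2_conv_all_nth hom_kernel_def)
      then show ?thesis using H[OF that] xys by (simp add: alg_hom_def)
    qed
    then show "(G f xs, G f ys) \<in> hom_kernel B H"
      using xys by (simp add: hom_kernel_def algebra_closed[OF alg])
  qed
  ultimately show ?thesis by (simp add: Con_def)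
qed

lemma Con_listrel1:
  assumes \<theta>: "\<theta> \<in> Con ar A F" and "length xs = ar f" "set xs \<subseteq> A" and "(xs, ys) \<in> listrel1 \<theta>"
  shows "(F f xs, F f ys) \<in> \<theta>"
proof (rule Con_compatible[OF \<theta> \<open>length xs = ar f\<close>])
  obtain y n where y: "(xs ! n, y) \<in> \<theta>" and ys: "ys = xs[n := y]"
    using \<open>(xs, ys) \<in> listrel1 \<theta>\<close> unfolding listrel1_iff_update by blast
  have "(xs ! i, ys ! i) \<in> \<theta>" if "i < length xs" for i
  proof -
    have "(xs ! i, xs ! i) \<in> \<theta>" using \<open>set xs \<subseteq> A\<close> that by (intro Con_refl[OF \<theta>]) auto
    then show ?thesis using y ys that by (cases "i = n") auto
  qed
  then show "(xs, ys) \<in> listrel \<theta>" by (simp add: listrel_iff_nth ys)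
qed

lemma compatible_trancl_Un:
  assumes \<alpha>: "\<alpha> \<in> Con ar A F" and \<beta>: "\<beta> \<in> Con ar A F"
  shows "compatible ar A F ((\<alpha> \<union> \<beta>)\<^sup>+)"
  unfolding compatible_def
proof (intro allI impI, elim conjE)
  fix f xs ys
  assume xs: "length xs = ar f" "set xs \<subseteq> A"
    and "list_all2 (\<lambda>x y. (x, y) \<in> (\<alpha> \<union> \<beta>)\<^sup>+) xs ys"
  then have "(xs, ys) \<in> listrel ((\<alpha> \<union> \<beta>)\<^sup>*)"
    by (auto simp: listrel_iff_nth list_all2_conv_all_nth intro: trancl_into_rtrancl)
  then have "(xs, ys) \<in> (listrel1 (\<alpha> \<union> \<beta>))\<^sup>*" by (simp only: listrel_rtrancl_eq_rtrancl_listrel1)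
  then have "length ys = ar f \<and> set ys \<subseteq> A \<and> (F f xs, F f ys) \<in> (\<alpha> \<union> \<beta>)\<^sup>+"
  proof (induction rule: rtrancl_induct)
    case base
    have "(F f xs, F f xs) \<in> \<alpha>"
      using xs Con_refl[OF \<alpha>]
      by (intro Con_compatible[OF \<alpha>]) (auto simp: listrel_iff_nth subset_iff)
    then show ?case using xs by (simp add: r_into_trancl')
  next
    case (step us vs)
    then consider "(us, vs) \<in> listrel1 \<alpha>" | "(us, vs) \<in> listrel1 \<beta>"
      by (auto simp: listrel1_iff_update)
    then have "(F f us, F f vs) \<in> \<alpha> \<union> \<beta>"
      using step.IH by cases (simp_all add: Con_listrel1[OF \<alpha>] Con_listrel1[OF \<beta>])
    moreover obtain y n where "y \<in> A" "vs = us[n := y]"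
      using step.hyps(2) Con_subset[OF \<alpha>] Con_subset[OF \<beta>] unfolding listrel1_iff_update by blast
    moreover from this have "set vs \<subseteq> A"
      using step.IH set_update_subset_insert[of us n y] by blast
    ultimately show ?case using step.IH trancl_into_trancl by fastforce
  qed
  then show "(F f xs, F f ys) \<in> (\<alpha> \<union> \<beta>)\<^sup>+" by blast
qed

lemma trancl_Un_Con:
  assumes \<alpha>: "\<alpha> \<in> Con ar A F" and \<beta>: "\<beta> \<in> Con ar A F"
  shows "(\<alpha> \<union> \<beta>)\<^sup>+ \<in> Con ar A F"
proof -
  have "equiv A ((\<alpha> \<union> \<beta>)\<^sup>+)"
  proof (rule equivI)
    show "(\<alpha> \<union> \<beta>)\<^sup>+ \<subseteq> A \<times> A"
      using Con_subset[OF \<alpha>] Con_subset[OF \<beta>] by (intro trancl_subset_Sigma) auto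
    show "refl_on A ((\<alpha> \<union> \<beta>)\<^sup>+)" using Con_refl[OF \<alpha>] by (simp add: refl_on_def r_into_trancl')
    have "sym (\<alpha> \<union> \<beta>)" using Con_sym[OF \<alpha>] Con_sym[OF \<beta>] unfolding sym_def by blast
    then show "sym ((\<alpha> \<union> \<beta>)\<^sup>+)" by (rule sym_trancl)
    show "trans ((\<alpha> \<union> \<beta>)\<^sup>+)" by (rule trans_trancl)
  qed
  then show ?thesis using compatible_trancl_Un[OF assms] by (simp add: Con_def)
qed

lemma con_join_eq_trancl:
  assumes \<alpha>: "\<alpha> \<in> Con ar A F" and \<beta>: "\<beta> \<in> Con ar A F"
  shows "con_join ar A F \<alpha> \<beta> = (\<alpha> \<union> \<beta>)\<^sup>+"
proof
  show "con_join ar A F \<alpha> \<beta> \<subseteq> (\<alpha> \<union> \<beta>)\<^sup>+"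
    unfolding con_join_def using trancl_incr[of "\<alpha> \<union> \<beta>"]
    by (intro Inter_lower) (simp add: trancl_Un_Con[OF assms])
  show "(\<alpha> \<union> \<beta>)\<^sup>+ \<subseteq> con_join ar A F \<alpha> \<beta>"
    unfolding con_join_def
  proof (rule Inter_greatest)
    fix \<kappa> assume "\<kappa> \<in> {\<theta> \<in> Con ar A F. \<alpha> \<union> \<beta> \<subseteq> \<theta>}"
    then have "trans \<kappa>" "\<alpha> \<union> \<beta> \<subseteq> \<kappa>" by (auto simp: Con_def equiv_def)
    then show "(\<alpha> \<union> \<beta>)\<^sup>+ \<subseteq> \<kappa>" using trancl_mono_subset[of "\<alpha> \<union> \<beta>" \<kappa>] by simp
  qed
qed

lemma Con_Int:
  assumes "\<alpha> \<in> Con ar A F" "\<beta> \<in> Con ar A F"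
  shows "\<alpha> \<inter> \<beta> \<in> Con ar A F"
proof -
  have "equiv A (\<alpha> \<inter> \<beta>)"
    using assms by (auto simp: Con_def equiv_def refl_on_def sym_Int trans_Int)
  moreover have "compatible ar A F (\<alpha> \<inter> \<beta>)"
    using assms unfolding Con_def compatible_def list_all2_conv_all_nth by simp
  ultimately show ?thesis by (simp add: Con_def)
qed

lemma con_modular_path:
  assumes modular: "con_modular ar A F"
    and con: "\<alpha> \<in> Con ar A F" "\<beta> \<in> Con ar A F" "\<gamma> \<in> Con ar A F" and "\<gamma> \<subseteq> \<beta>"
    and path: "(a, b) \<in> \<alpha>" "(b, c) \<in> \<gamma>" "(c, d) \<in> \<alpha>" and "(a, d) \<in> \<beta>"
  shows "(a, d) \<in> (\<gamma> \<union> \<alpha> \<inter> \<beta>)\<^sup>+"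
proof -
  have "(a, b) \<in> (\<gamma> \<union> \<alpha>)\<^sup>+" using path(1) by (simp add: r_into_trancl')
  also have "(b, c) \<in> \<gamma> \<union> \<alpha>" using path(2) by simp
  also have "(c, d) \<in> \<gamma> \<union> \<alpha>" using path(3) by simp
  finally have "(a, d) \<in> (\<gamma> \<union> \<alpha>)\<^sup>+" .
  then have "(a, d) \<in> con_join ar A F \<gamma> \<alpha> \<inter> \<beta>"
    using \<open>(a, d) \<in> \<beta>\<close> by (simp add: con_join_eq_trancl con)
  also have "\<dots> = con_join ar A F \<gamma> (\<alpha> \<inter> \<beta>)"
    using modular con \<open>\<gamma> \<subseteq> \<beta>\<close> unfolding con_modular_def by blast
  also have "\<dots> = (\<gamma> \<union> \<alpha> \<inter> \<beta>)\<^sup>+" by (simp add: con_join_eq_trancl con Con_Int)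
  finally show ?thesis .
qed

subsection \<open>A free algebra carried by words\<close>

text \<open>Words are reverse Polish programs: a block of \<open>i + 1\<close> letters \<open>Inl _\<close> closed by any \<open>Inr _\<close>
  pushes \<open>Var i\<close>, and an \<open>Inr f\<close> outside such a block applies \<open>f\<close> to the top of the stack.\<close>
fun rpn_step :: "('f \<Rightarrow> nat) \<Rightarrow> 'a + 'f \<Rightarrow> nat \<times> ('f, nat) trm list \<Rightarrow> nat \<times> ('f, nat) trm list"
  where
  "rpn_step ar (Inl a) (c, st) = (Suc c, st)"
| "rpn_step ar (Inr f) (0, st) = (0, Fn f (rev (take (ar f) st)) # drop (ar f) st)"
| "rpn_step ar (Inr f) (Suc c, st) = (0, Var c # st)"

definition rpn_decode :: "('f \<Rightarrow> nat) \<Rightarrow> ('a + 'f) list \<Rightarrow> ('f, nat) trm" where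
  "rpn_decode ar l = hd (snd (fold (rpn_step ar) l (0, [])))"

fun rpn_encode :: "('f, nat) trm \<Rightarrow> ('a + 'f) list" where
  "rpn_encode (Var i) = replicate (Suc i) (Inl undefined) @ [Inr undefined]"
| "rpn_encode (Fn f ts) = concat (map rpn_encode ts) @ [Inr f]"

lemma fold_rpn_step_replicate_Inl:
  "fold (rpn_step ar) (replicate i (Inl a)) (c, st) = (c + i, st)"
  by (induction i arbitrary: c) auto

lemma fold_rpn_step_encode:
  fixes ar :: "'f \<Rightarrow> nat"
  assumes "wf_trm ar t"
  shows "fold (rpn_step ar) (rpn_encode t :: ('a + 'f) list) (0, st) = (0, t # st)"
  using assms
proof (induction t arbitrary: st)
  case (Var i)
  show ?case by (simp add: fold_rpn_step_replicate_Inl del: replicate_Suc fold_replicate)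
next
  case (Fn f ts)
  have "fold (rpn_step ar) (concat (map rpn_encode us) :: ('a + 'f) list) (0, st) =
      (0, rev us @ st)"
    if "set us \<subseteq> set ts" for us
    using that
  proof (induction us arbitrary: st)
    case (Cons u us)
    then have "fold (rpn_step ar) (rpn_encode u :: ('a + 'f) list) (0, st) = (0, u # st)"
      using Fn.prems by (auto intro!: Fn.IH)
    then show ?case using Cons by simp
  qed simp
  then show ?case using Fn.prems by simp
qed

lemma rpn_decode_encode: "wf_trm ar t \<Longrightarrow> rpn_decode ar (rpn_encode t) = t"
  by (simp add: rpn_decode_def fold_rpn_step_encode)

context
  fixes ar :: "'f \<Rightarrow> nat" and A :: "'a set" and F :: "'f \<Rightarrow> 'a list \<Rightarrow> 'a"
begin

definition free_rep :: "('f, nat) trm \<Rightarrow> ('a + 'f) list" where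
  "free_rep t = (SOME l. wf_trm ar (rpn_decode ar l) \<and> satisfies_id A F (rpn_decode ar l) t)"

definition free_carrier :: "('a + 'f) list set" where
  "free_carrier = free_rep ` {t. wf_trm ar t}"

definition free_op :: "'f \<Rightarrow> ('a + 'f) list list \<Rightarrow> ('a + 'f) list" where
  "free_op f ls = free_rep (Fn f (map (rpn_decode ar) ls))"

definition free_eval :: "(nat \<Rightarrow> 'a) \<Rightarrow> ('a + 'f) list \<Rightarrow> 'a" where
  "free_eval e l = eval_trm F e (rpn_decode ar l)"

lemma decode_free_rep:
  assumes "wf_trm ar t"
  shows "wf_trm ar (rpn_decode ar (free_rep t)) \<and> satisfies_id A F (rpn_decode ar (free_rep t)) t"
  unfolding free_rep_def
  by (rule someI[of _ "rpn_encode t"]) (simp add: rpn_decode_encode assms satisfies_id_def)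

lemma free_rep_cong: "satisfies_id A F s t \<Longrightarrow> free_rep s = free_rep t"
  unfolding free_rep_def satisfies_id_def by (rule arg_cong[where f = Eps]) auto

lemma free_carrier_wf: "l \<in> free_carrier \<Longrightarrow> wf_trm ar (rpn_decode ar l)"
  by (auto simp: free_carrier_def decode_free_rep)

lemma free_algebra: "algebra ar free_carrier free_op"
  unfolding algebra_def
proof (intro conjI allI impI)
  show "free_carrier \<noteq> {}" by (auto simp: free_carrier_def intro: exI[of _ "Var 0"])
next
  fix f xs assume "length xs = ar f \<and> set xs \<subseteq> free_carrier"
  then have "wf_trm ar (Fn f (map (rpn_decode ar) xs))" by (auto intro: free_carrier_wf)
  then show "free_op f xs \<in> free_carrier" unfolding free_op_def free_carrier_def by blast
qed

lemma free_eval_free_rep: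
  "wf_trm ar t \<Longrightarrow> (\<And>v. e v \<in> A) \<Longrightarrow> free_eval e (free_rep t) = eval_trm F e t"
  using decode_free_rep by (simp add: free_eval_def satisfies_id_def)

lemma free_eval_hom:
  assumes alg: "algebra ar A F" and e: "\<And>v. e v \<in> A"
  shows "alg_hom ar free_carrier free_op A F (free_eval e)"
  unfolding alg_hom_def
proof (intro conjI allI impI)
  show "free_eval e ` free_carrier \<subseteq> A"
    by (auto simp: free_eval_def intro!: eval_trm_closed[OF alg] e free_carrier_wf)
next
  fix f xs assume "length xs = ar f \<and> set xs \<subseteq> free_carrier"
  then have "wf_trm ar (Fn f (map (rpn_decode ar) xs))" by (auto intro: free_carrier_wf)
  then show "free_eval e (free_op f xs) = F f (map (free_eval e) xs)"
    by (simp add: free_op_def free_eval_free_rep e comp_def) (simp add: free_eval_def[abs_def])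
qed

lemma free_in_variety:
  assumes alg: "algebra ar A F"
  shows "in_variety_of ar A F free_carrier free_op"
proof (rule in_variety_of_separated[OF free_algebra])
  fix p q
  assume "p \<in> free_carrier" "q \<in> free_carrier"
    and agree: "\<And>h. alg_hom ar free_carrier free_op A F h \<Longrightarrow> h p = h q"
  then obtain s t where s: "wf_trm ar s" "p = free_rep s" and t: "wf_trm ar t" "q = free_rep t"
    by (auto simp: free_carrier_def)
  have "eval_trm F e s = eval_trm F e t" if e: "\<And>v. e v \<in> A" for e
    using agree[OF free_eval_hom[OF alg e]] s t e by (simp add: free_eval_free_rep)
  then show "p = q" unfolding s t by (intro free_rep_cong) (simp add: satisfies_id_def)
qed

definition free_kernel :: "(nat \<Rightarrow> 'a) set \<Rightarrow> ('a + 'f) list rel" where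
  "free_kernel E = hom_kernel free_carrier (free_eval ` E)"

lemma free_kernel_Con:
  assumes alg: "algebra ar A F" and E: "\<And>e v. e \<in> E \<Longrightarrow> e v \<in> A"
  shows "free_kernel E \<in> Con ar free_carrier free_op"
  unfolding free_kernel_def
  by (rule hom_kernel_Con[OF free_algebra]) (auto intro: free_eval_hom[OF alg] E)

lemma free_kernel_free_rep_iff:
  assumes "\<And>e v. e \<in> E \<Longrightarrow> e v \<in> A" and "wf_trm ar s" "wf_trm ar t"
  shows "(free_rep s, free_rep t) \<in> free_kernel E \<longleftrightarrow> (\<forall>e\<in>E. eval_trm F e s = eval_trm F e t)"
  using assms by (simp add: free_kernel_def hom_kernel_def free_carrier_def free_eval_free_rep)

end

subsection \<open>Day terms\<close>

definition env4 :: "'a \<Rightarrow> 'a \<Rightarrow> 'a \<Rightarrow> 'a \<Rightarrow> nat \<Rightarrow> 'a" where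
  "env4 x y z w v = (if v = 0 then x else if v = 1 then y else if v = 2 then z else w)"

definition eval4 ::
  "('f \<Rightarrow> 'a list \<Rightarrow> 'a) \<Rightarrow> ('f, nat) trm \<Rightarrow> 'a \<Rightarrow> 'a \<Rightarrow> 'a \<Rightarrow> 'a \<Rightarrow> 'a" where
  "eval4 F t x y z w = eval_trm F (env4 x y z w) t"

lemma env4_closed: "x \<in> A \<Longrightarrow> y \<in> A \<Longrightarrow> z \<in> A \<Longrightarrow> w \<in> A \<Longrightarrow> env4 x y z w v \<in> A"
  by (simp add: env4_def)

lemma eval4_closed:
  assumes "algebra ar A F" "wf_trm ar t" "x \<in> A" "y \<in> A" "z \<in> A" "w \<in> A"
  shows "eval4 F t x y z w \<in> A"
  unfolding eval4_def using assms by (intro eval_trm_closed env4_closed)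

lemma eval4_Con:
  assumes "\<theta> \<in> Con ar A F" "wf_trm ar t"
    and "(x, x') \<in> \<theta>" "(y, y') \<in> \<theta>" "(z, z') \<in> \<theta>" "(w, w') \<in> \<theta>"
  shows "(eval4 F t x y z w, eval4 F t x' y' z' w') \<in> \<theta>"
  unfolding eval4_def using assms by (intro eval_trm_Con[OF assms(1,2)]) (simp add: env4_def)

lemma alg_hom_eval4:
  assumes "algebra ar A F" "alg_hom ar A F B G h" "wf_trm ar t" "x \<in> A" "y \<in> A" "z \<in> A" "w \<in> A"
  shows "h (eval4 F t x y z w) = eval4 G t (h x) (h y) (h z) (h w)"
proof -
  have "(\<lambda>v. h (env4 x y z w v)) = env4 (h x) (h y) (h z) (h w)" by (auto simp: env4_def)
  then show ?thesis
    unfolding eval4_def using assms by (simp add: alg_hom_eval_trm env4_closed)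
qed

definition day_terms ::
  "('f \<Rightarrow> nat) \<Rightarrow> 'a set \<Rightarrow> ('f \<Rightarrow> 'a list \<Rightarrow> 'a) \<Rightarrow> ('f, nat) trm set" where
  "day_terms ar A F = {t. wf_trm ar t \<and> (\<forall>x\<in>A. \<forall>y\<in>A. eval4 F t x y y x = x)}"

definition day_step ::
  "('f \<Rightarrow> nat) \<Rightarrow> 'a set \<Rightarrow> ('f \<Rightarrow> 'a list \<Rightarrow> 'a) \<Rightarrow> ('f, nat) trm rel" where
  "day_step ar A F = {(s, t). s \<in> day_terms ar A F \<and> t \<in> day_terms ar A F \<and>
     ((\<forall>x\<in>A. \<forall>y\<in>A. \<forall>z\<in>A. eval4 F s x y y z = eval4 F t x y y z) \<or>
      (\<forall>x\<in>A. \<forall>z\<in>A. eval4 F s x x z z = eval4 F t x x z z))}"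

definition envs_xyyz :: "'a set \<Rightarrow> (nat \<Rightarrow> 'a) set" where
  "envs_xyyz A = {env4 x y y z | x y z. x \<in> A \<and> y \<in> A \<and> z \<in> A}"

definition envs_xyyx :: "'a set \<Rightarrow> (nat \<Rightarrow> 'a) set" where
  "envs_xyyx A = {env4 x y y x | x y. x \<in> A \<and> y \<in> A}"

definition envs_xxzz :: "'a set \<Rightarrow> (nat \<Rightarrow> 'a) set" where
  "envs_xxzz A = {env4 x x z z | x z. x \<in> A \<and> z \<in> A}"

lemmas envs_defs = envs_xyyz_def envs_xyyx_def envs_xxzz_def

lemma envs_closed:
  "e \<in> envs_xyyz A \<Longrightarrow> e v \<in> A"
  "e \<in> envs_xyyx A \<Longrightarrow> e v \<in> A"
  "e \<in> envs_xxzz A \<Longrightarrow> e v \<in> A"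
  unfolding envs_defs by (auto intro: env4_closed)

context
  fixes ar :: "'f \<Rightarrow> nat" and A :: "'a set" and F :: "'f \<Rightarrow> 'a list \<Rightarrow> 'a"
begin

private abbreviation rep :: "('f, nat) trm \<Rightarrow> ('a + 'f) list" where
  "rep \<equiv> free_rep ar A F"

private abbreviation ker :: "(nat \<Rightarrow> 'a) set \<Rightarrow> ('a + 'f) list rel" where
  "ker \<equiv> free_kernel ar A F"

private abbreviation path_rel :: "('a + 'f) list rel" where
  "path_rel \<equiv> ker (envs_xyyz A) \<union> ker (envs_xxzz A) \<inter> ker (envs_xyyx A)"

lemma free_rep_kernel_iff:
  assumes "wf_trm ar s" "wf_trm ar t"
  shows "(rep s, rep t) \<in> ker (envs_xyyz A) \<longleftrightarrow>
      (\<forall>x\<in>A. \<forall>y\<in>A. \<forall>z\<in>A. eval4 F s x y y z = eval4 F t x y y z)"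
    and "(rep s, rep t) \<in> ker (envs_xyyx A) \<longleftrightarrow>
      (\<forall>x\<in>A. \<forall>y\<in>A. eval4 F s x y y x = eval4 F t x y y x)"
    and "(rep s, rep t) \<in> ker (envs_xxzz A) \<longleftrightarrow>
      (\<forall>x\<in>A. \<forall>z\<in>A. eval4 F s x x z z = eval4 F t x x z z)"
  using assms by (simp_all add: free_kernel_free_rep_iff envs_closed)
    (auto simp: envs_defs eval4_def)

lemma free_generators_path:
  assumes alg: "algebra ar A F" and cm: "in_CM_variety ar A F"
  shows "(rep (Var 0), rep (Var 3)) \<in> path_rel\<^sup>+"
proof (rule con_modular_path)
  show "con_modular ar (free_carrier ar A F) (free_op ar A F)"
    using cm free_in_variety[OF alg] by (simp add: in_CM_variety_def)
  show "ker (envs_xyyz A) \<in> Con ar (free_carrier ar A F) (free_op ar A F)"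
    by (rule free_kernel_Con[OF alg]) (erule envs_closed(1))
  show "ker (envs_xyyx A) \<in> Con ar (free_carrier ar A F) (free_op ar A F)"
    by (rule free_kernel_Con[OF alg]) (erule envs_closed(2))
  show "ker (envs_xxzz A) \<in> Con ar (free_carrier ar A F) (free_op ar A F)"
    by (rule free_kernel_Con[OF alg]) (erule envs_closed(3))
  have "envs_xyyx A \<subseteq> envs_xyyz A" unfolding envs_defs by blast
  then show "ker (envs_xyyz A) \<subseteq> ker (envs_xyyx A)"
    unfolding free_kernel_def hom_kernel_def by blast
  show "(rep (Var 0), rep (Var 1)) \<in> ker (envs_xxzz A)"
    "(rep (Var 1), rep (Var 2)) \<in> ker (envs_xyyz A)"
    "(rep (Var 2), rep (Var 3)) \<in> ker (envs_xxzz A)"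
    "(rep (Var 0), rep (Var 3)) \<in> ker (envs_xyyx A)"
    by (simp_all add: free_rep_kernel_iff eval4_def env4_def)
qed

lemma day_stepI:
  assumes "s \<in> day_terms ar A F" "wf_trm ar t" and "(rep s, rep t) \<in> path_rel"
  shows "(s, t) \<in> day_step ar A F"
  using assms by (auto simp: day_step_def day_terms_def free_rep_kernel_iff)

lemma day_chain:
  assumes alg: "algebra ar A F" and cm: "in_CM_variety ar A F"
  shows "(Var 0, Var 3) \<in> (day_step ar A F)\<^sup>*"
proof -
  have reach: "(Var 0, t) \<in> (day_step ar A F)\<^sup>*"
    if "wf_trm ar s" "(Var 0, s) \<in> (day_step ar A F)\<^sup>*" "wf_trm ar t"
      "(rep s, rep t) \<in> path_rel" for s t
  proof -
    have "Var 0 \<in> day_terms ar A F" by (simp add: day_terms_def eval4_def env4_def)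
    with that(2) have "s \<in> day_terms ar A F" by (cases rule: rtranclE) (simp_all add: day_step_def)
    from that(2) day_stepI[OF this that(3,4)] show ?thesis by (rule rtrancl_into_rtrancl)
  qed
  have "\<forall>t. wf_trm ar t \<and> rep t = l \<longrightarrow> (Var 0, t) \<in> (day_step ar A F)\<^sup>*"
    if "(rep (Var 0), l) \<in> path_rel\<^sup>+" for l
    using that
  proof (induction rule: trancl_induct)
    case (base l)
    then show ?case using reach[of "Var 0"] by simp
  next
    case (step l l')
    from step.hyps(2) have "l \<in> free_carrier ar A F" by (auto simp: free_kernel_def hom_kernel_def)
    then obtain s where "wf_trm ar s" "rep s = l" by (auto simp: free_carrier_def)
    with step show ?case by (metis reach)
  qed
  from this[OF free_generators_path[OF alg cm]] show ?thesis by simp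
qed

end

text \<open>Along the chain \<open>a\<close> stays \<open>\<delta>\<close>-related to \<open>t(a, b, d, c)\<close>, which is \<open>c\<close> at its end.\<close>
lemma day_terms_separate:
  assumes alg: "algebra ar A F" and cm: "in_CM_variety ar A F" and \<delta>: "\<delta> \<in> Con ar A F"
    and A: "a \<in> A" "c \<in> A" and bd: "(b, d) \<in> \<delta>"
    and day: "\<And>t. t \<in> day_terms ar A F \<Longrightarrow> (eval4 F t a b d c, eval4 F t a a c c) \<in> \<delta>"
  shows "(a, c) \<in> \<delta>"
proof -
  have bdA: "b \<in> A" "d \<in> A" using bd Con_subset[OF \<delta>] by auto
  have via: "(p, q) \<in> \<delta>" if "(p, r) \<in> \<delta>" "(q, r) \<in> \<delta>" for p q r
    using Con_trans[OF \<delta> that(1)] Con_sym[OF \<delta> that(2)] .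
  have link: "(eval4 F s a b d c, eval4 F t a b d c) \<in> \<delta>" if st: "(s, t) \<in> day_step ar A F" for s t
  proof -
    have terms: "s \<in> day_terms ar A F" "t \<in> day_terms ar A F" using st by (auto simp: day_step_def)
    then have wf: "wf_trm ar s" "wf_trm ar t" by (auto simp: day_terms_def)
    have rel: "(eval4 F r a b d c, eval4 F r a b b c) \<in> \<delta>" if "wf_trm ar r" for r
      using that A bdA Con_sym[OF \<delta> bd] by (intro eval4_Con[OF \<delta>]) (simp_all add: Con_refl[OF \<delta>])
    consider "eval4 F s a b b c = eval4 F t a b b c" | "eval4 F s a a c c = eval4 F t a a c c"
      using st A bdA by (auto simp: day_step_def)
    then show ?thesis
    proof cases
      case 1
      then show ?thesis using via[OF rel[OF wf(1)]] rel[OF wf(2)] by simp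
    next
      case 2
      then show ?thesis using via[OF day[OF terms(1)]] day[OF terms(2)] by simp
    qed
  qed
  have "(a, eval4 F t a b d c) \<in> \<delta>" if "(Var 0, t) \<in> (day_step ar A F)\<^sup>*" for t
    using that
  proof (induction rule: rtrancl_induct)
    case base
    then show ?case using A by (simp add: eval4_def env4_def Con_refl[OF \<delta>])
  next
    case (step s t)
    show ?case using Con_trans[OF \<delta> step.IH link[OF step.hyps(2)]] .
  qed
  from this[OF day_chain[OF alg cm]] show ?thesis by (simp add: eval4_def env4_def)
qed

lemma day_terms_rectangle:
  assumes \<delta>: "\<delta> \<in> Con ar A F" and t: "t \<in> day_terms ar A F"
    and ac: "(a, c) \<in> \<delta>" and bd: "(b, d) \<in> \<delta>"
  shows "(eval4 F t a b d c, eval4 F t a a c c) \<in> \<delta>"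
proof -
  have wf: "wf_trm ar t" using t by (simp add: day_terms_def)
  have A: "a \<in> A" "b \<in> A" using ac bd Con_subset[OF \<delta>] by auto
  then have refl: "(a, a) \<in> \<delta>" "(b, b) \<in> \<delta>" by (simp_all add: Con_refl[OF \<delta>])
  have "(eval4 F t a b d c, eval4 F t a b b a) \<in> \<delta>"
    using bd[THEN Con_sym[OF \<delta>]] ac[THEN Con_sym[OF \<delta>]] refl by (intro eval4_Con[OF \<delta> wf])
  moreover have "eval4 F t a b b a = eval4 F t a a a a" using t A by (simp add: day_terms_def)
  moreover have "(eval4 F t a a a a, eval4 F t a a c c) \<in> \<delta>"
    using ac refl by (intro eval4_Con[OF \<delta> wf])
  ultimately show ?thesis using Con_trans[OF \<delta>] by metis
qed

subsection \<open>Cubes and higher dimensional tolerances\<close>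

lemma cubes_value: "\<gamma> \<in> cubes S A \<Longrightarrow> u \<subseteq> S \<Longrightarrow> \<gamma> u \<in> A"
  by (auto simp: cubes_def)

lemma restrict_in_cubes: "(\<And>u. u \<subseteq> S \<Longrightarrow> g u \<in> A) \<Longrightarrow> (\<lambda>u\<in>Pow S. g u) \<in> cubes S A"
  by (simp add: cubes_def)

lemma cubes_eqI:
  "\<gamma> \<in> cubes S A \<Longrightarrow> \<gamma>' \<in> cubes S A \<Longrightarrow> (\<And>u. u \<subseteq> S \<Longrightarrow> \<gamma> u = \<gamma>' u) \<Longrightarrow> \<gamma> = \<gamma>'"
  unfolding cubes_def by (erule PiE_ext) simp_all

definition cube_op ::
  "nat set \<Rightarrow> ('f \<Rightarrow> 'a list \<Rightarrow> 'a) \<Rightarrow> 'f \<Rightarrow> (nat set \<Rightarrow> 'a) list \<Rightarrow> nat set \<Rightarrow> 'a" where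
  "cube_op S F f \<gamma>s = (\<lambda>u\<in>Pow S. F f (map (\<lambda>\<gamma>. \<gamma> u) \<gamma>s))"

lemma cube_op_apply: "u \<subseteq> S \<Longrightarrow> cube_op S F f \<gamma>s u = F f (map (\<lambda>\<gamma>. \<gamma> u) \<gamma>s)"
  by (simp add: cube_op_def)

lemma cube_subuniverse_iff:
  "cube_subuniverse ar A F S R \<longleftrightarrow> R \<subseteq> cubes S A \<and>
     (\<forall>f \<gamma>s. length \<gamma>s = ar f \<and> set \<gamma>s \<subseteq> R \<longrightarrow> cube_op S F f \<gamma>s \<in> R)"
  by (simp add: cube_subuniverse_def cube_op_def)

lemma cube_subuniverse_algebra:
  "cube_subuniverse ar A F S R \<Longrightarrow> R \<noteq> {} \<Longrightarrow> algebra ar R (cube_op S F)"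
  by (simp add: cube_subuniverse_iff algebra_def)

lemma cube_subuniverse_cubes:
  assumes alg: "algebra ar A F"
  shows "cube_subuniverse ar A F S (cubes S A)"
  unfolding cube_subuniverse_iff
proof (intro conjI allI impI subset_refl)
  fix f \<gamma>s assume "length \<gamma>s = ar f \<and> set \<gamma>s \<subseteq> cubes S A"
  then show "cube_op S F f \<gamma>s \<in> cubes S A"
    unfolding cube_op_def
    by (intro restrict_in_cubes algebra_closed[OF alg]) (auto intro: cubes_value)
qed

lemma cubes_eval4_apply:
  assumes alg: "algebra ar A F" and "wf_trm ar t" and "u \<subseteq> S"
    and "\<gamma>\<^sub>1 \<in> cubes S A" "\<gamma>\<^sub>2 \<in> cubes S A" "\<gamma>\<^sub>3 \<in> cubes S A" "\<gamma>\<^sub>4 \<in> cubes S A"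
  shows "eval4 (cube_op S F) t \<gamma>\<^sub>1 \<gamma>\<^sub>2 \<gamma>\<^sub>3 \<gamma>\<^sub>4 u = eval4 F t (\<gamma>\<^sub>1 u) (\<gamma>\<^sub>2 u) (\<gamma>\<^sub>3 u) (\<gamma>\<^sub>4 u)"
proof -
  have "algebra ar (cubes S A) (cube_op S F)"
    using cube_subuniverse_algebra[OF cube_subuniverse_cubes[OF alg]] assms(4) by blast
  moreover have "alg_hom ar (cubes S A) (cube_op S F) A F (\<lambda>\<gamma>. \<gamma> u)"
    using \<open>u \<subseteq> S\<close> by (auto simp: alg_hom_def cube_op_apply intro: cubes_value)
  ultimately show ?thesis using assms by (simp add: alg_hom_eval4[where h = "\<lambda>\<gamma>. \<gamma> u"])
qed

definition act_coord :: "nat \<Rightarrow> (bool \<Rightarrow> bool) \<Rightarrow> nat set \<Rightarrow> nat set" where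
  "act_coord i \<phi> u = (if \<phi> (i \<in> u) then insert i u else u - {i})"

definition act_cube :: "nat set \<Rightarrow> nat \<Rightarrow> (bool \<Rightarrow> bool) \<Rightarrow> (nat set \<Rightarrow> 'a) \<Rightarrow> nat set \<Rightarrow> 'a" where
  "act_cube S i \<phi> \<gamma> = (\<lambda>u\<in>Pow S. \<gamma> (act_coord i \<phi> u))"

lemma mem_act_coord_iff: "k \<in> act_coord i \<phi> u \<longleftrightarrow> (if k = i then \<phi> (k \<in> u) else k \<in> u)"
  by (auto simp: act_coord_def)

lemma act_coord_subset: "i \<in> S \<Longrightarrow> u \<subseteq> S \<Longrightarrow> act_coord i \<phi> u \<subseteq> S"
  by (auto simp: act_coord_def)

lemma act_cube_apply: "u \<subseteq> S \<Longrightarrow> act_cube S i \<phi> \<gamma> u = \<gamma> (act_coord i \<phi> u)"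
  by (simp add: act_cube_def)

lemma act_cube_closed: "i \<in> S \<Longrightarrow> \<gamma> \<in> cubes S A \<Longrightarrow> act_cube S i \<phi> \<gamma> \<in> cubes S A"
  unfolding act_cube_def by (rule restrict_in_cubes) (simp add: cubes_value act_coord_subset)

lemma refl_cube_eq_act_cube: "i \<in> S \<Longrightarrow> refl_cube S i j \<gamma> = act_cube S i (\<lambda>_. j) \<gamma>"
  by (rule ext)
    (auto simp: refl_cube_def glue_def face_def act_cube_def act_coord_def insert_absorb)

lemma sym_cube_eq_act_cube: "i \<in> S \<Longrightarrow> sym_cube S i \<gamma> = act_cube S i Not \<gamma>"
  by (rule ext) (auto simp: sym_cube_def glue_def face_def act_cube_def act_coord_def)

lemma act_cube_id:
  assumes "\<gamma> \<in> cubes S A" "i \<in> S"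
  shows "act_cube S i (\<lambda>b. b) \<gamma> = \<gamma>"
proof (rule cubes_eqI[OF act_cube_closed assms(1)])
  show "act_cube S i (\<lambda>b. b) \<gamma> u = \<gamma> u" if "u \<subseteq> S" for u
    using that by (simp add: act_cube_apply act_coord_def insert_absorb)
qed (rule assms)+

lemma refl_cube_apply:
  "i \<in> S \<Longrightarrow> u \<subseteq> S \<Longrightarrow> refl_cube S i j \<gamma> u = \<gamma> (if j then insert i u else u - {i})"
  by (simp add: refl_cube_eq_act_cube act_cube_apply act_coord_def)

lemma refl_cube_closed: "i \<in> S \<Longrightarrow> \<gamma> \<in> cubes S A \<Longrightarrow> refl_cube S i j \<gamma> \<in> cubes S A"
  by (simp add: refl_cube_eq_act_cube act_cube_closed)

lemma bool_fun_cases: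
  obtains j where "\<phi> = (\<lambda>_ :: bool. j :: bool)" | "\<phi> = Not" | "\<phi> = (\<lambda>b. b)"
proof (cases "\<phi> True"; cases "\<phi> False")
  assume "\<phi> True" "\<phi> False"
  then have "\<phi> b" for b by (cases b) auto
  then show thesis using that(1)[of True] by auto
next
  assume "\<phi> True" "\<not> \<phi> False"
  then have "\<phi> b = b" for b by (cases b) auto
  then show thesis using that(3) by auto
next
  assume "\<not> \<phi> True" "\<phi> False"
  then have "\<phi> b = (\<not> b)" for b by (cases b) auto
  then show thesis using that(2) by auto
next
  assume "\<not> \<phi> True" "\<not> \<phi> False"
  then have "\<not> \<phi> b" for b by (cases b) auto
  then show thesis using that(1)[of False] by auto
qed

lemma hd_tolerance_iff:
  "hd_tolerance ar A F S R \<longleftrightarrow> cube_subuniverse ar A F S R \<and>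
     (\<forall>\<gamma>\<in>R. \<forall>i\<in>S. \<forall>\<phi>. act_cube S i \<phi> \<gamma> \<in> R)"
proof -
  have "(\<forall>j. refl_cube S i j \<gamma> \<in> R) \<and> sym_cube S i \<gamma> \<in> R \<longleftrightarrow> (\<forall>\<phi>. act_cube S i \<phi> \<gamma> \<in> R)"
    if \<gamma>: "\<gamma> \<in> R" "\<gamma> \<in> cubes S A" and i: "i \<in> S" for \<gamma> i
  proof (intro iffI allI)
    fix \<phi>
    assume "(\<forall>j. refl_cube S i j \<gamma> \<in> R) \<and> sym_cube S i \<gamma> \<in> R"
    then have "act_cube S i (\<lambda>_. j) \<gamma> \<in> R" "act_cube S i Not \<gamma> \<in> R" for j
      using i by (simp_all add: refl_cube_eq_act_cube sym_cube_eq_act_cube)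
    moreover have "act_cube S i (\<lambda>b. b) \<gamma> \<in> R" using \<gamma> i by (simp add: act_cube_id)
    ultimately show "act_cube S i \<phi> \<gamma> \<in> R" by (cases rule: bool_fun_cases[of \<phi>]) simp_all
  qed (simp add: refl_cube_eq_act_cube sym_cube_eq_act_cube i)
  moreover have "R \<subseteq> cubes S A" if "cube_subuniverse ar A F S R"
    using that by (simp add: cube_subuniverse_iff)
  ultimately show ?thesis
    unfolding hd_tolerance_def by (intro conj_cong refl ball_cong) auto
qed

lemma hd_tolerance_cubes: "hd_tolerance ar A F S R \<Longrightarrow> \<gamma> \<in> R \<Longrightarrow> \<gamma> \<in> cubes S A"
  by (auto simp: hd_tolerance_def cube_subuniverse_def)

lemma cube_subuniverse_vimage_act_cube:
  assumes R: "cube_subuniverse ar A F S R" and i: "i \<in> S"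
  shows "cube_subuniverse ar A F S {\<gamma> \<in> R. act_cube S i \<phi> \<gamma> \<in> R}"
  unfolding cube_subuniverse_iff
proof (intro conjI allI impI)
  show "{\<gamma> \<in> R. act_cube S i \<phi> \<gamma> \<in> R} \<subseteq> cubes S A" using R by (auto simp: cube_subuniverse_iff)
  have closed: "cube_op S F f \<gamma>s \<in> R" if "length \<gamma>s = ar f" "set \<gamma>s \<subseteq> R" for f \<gamma>s
    using R that by (simp add: cube_subuniverse_iff)
  fix f \<gamma>s assume \<gamma>s: "length \<gamma>s = ar f \<and> set \<gamma>s \<subseteq> {\<gamma> \<in> R. act_cube S i \<phi> \<gamma> \<in> R}"
  have "act_cube S i \<phi> (cube_op S F f \<gamma>s) = cube_op S F f (map (act_cube S i \<phi>) \<gamma>s)"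
    unfolding act_cube_def cube_op_def
    by (rule restrict_ext) (simp add: act_coord_subset[OF i] comp_def)
  moreover have "cube_op S F f (map (act_cube S i \<phi>) \<gamma>s) \<in> R" using \<gamma>s by (intro closed) auto
  ultimately show "cube_op S F f \<gamma>s \<in> {\<gamma> \<in> R. act_cube S i \<phi> \<gamma> \<in> R}"
    using \<gamma>s closed by auto
qed

subsection \<open>Shifting lines to another direction\<close>

definition delta_line :: "'a rel \<Rightarrow> nat \<Rightarrow> (nat set \<Rightarrow> 'a) \<Rightarrow> nat set \<Rightarrow> bool" where
  "delta_line \<delta> i \<gamma> u \<longleftrightarrow> (\<gamma> u, \<gamma> (insert i u)) \<in> \<delta>"

lemma central_at_iff:
  assumes "i \<in> S"
  shows "central_at S \<delta> i R \<longleftrightarrow>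
    (\<forall>\<gamma>\<in>R. (\<forall>u. u \<subset> S - {i} \<longrightarrow> delta_line \<delta> i \<gamma> u) \<longrightarrow> delta_line \<delta> i \<gamma> (S - {i}))"
  using assms by (simp add: central_at_def delta_line_def psubset_eq insert_absorb)

text \<open>On the square \<open>b = \<gamma> w\<close>, \<open>a = \<gamma> (w \<union> {j})\<close>, \<open>d = \<gamma> (w \<union> {i})\<close>, \<open>c = \<gamma> (w \<union> {i, j})\<close> the
  new cube has the constant \<open>j\<close>-line \<open>(a, a)\<close> at \<open>w\<close> and the \<open>j\<close>-line
  \<open>(t(a, b, d, c), t(a, a, c, c))\<close> at \<open>w \<union> {i}\<close>.\<close>
definition day_shift ::
  "('f \<Rightarrow> 'a list \<Rightarrow> 'a) \<Rightarrow> nat set \<Rightarrow> nat \<Rightarrow> nat \<Rightarrow> ('f, nat) trm \<Rightarrow> (nat set \<Rightarrow> 'a) \<Rightarrow> nat set \<Rightarrow> 'a"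
  where
  "day_shift F S i j t \<gamma> = eval4 (cube_op S F) t
     (refl_cube S i False (refl_cube S j True \<gamma>)) (refl_cube S i False \<gamma>) \<gamma> (refl_cube S j True \<gamma>)"

lemma day_shift_closed:
  assumes R: "hd_tolerance ar A F S R" and "\<gamma> \<in> R" "i \<in> S" "j \<in> S" and "wf_trm ar t"
  shows "day_shift F S i j t \<gamma> \<in> R"
proof -
  have "cube_subuniverse ar A F S R" using R by (simp add: hd_tolerance_def)
  then have "algebra ar R (cube_op S F)" using \<open>\<gamma> \<in> R\<close> by (intro cube_subuniverse_algebra) auto
  then show ?thesis
    unfolding day_shift_def using assms by (intro eval4_closed) (simp_all add: hd_tolerance_def)
qed

lemma day_shift_apply:
  assumes "algebra ar A F" "wf_trm ar t" "\<gamma> \<in> cubes S A" "i \<in> S" "j \<in> S" "u \<subseteq> S"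
  shows "day_shift F S i j t \<gamma> u =
    eval4 F t (\<gamma> (insert j (u - {i}))) (\<gamma> (u - {i})) (\<gamma> u) (\<gamma> (insert j u))"
proof -
  have "u - {i} \<subseteq> S" using \<open>u \<subseteq> S\<close> by auto
  then show ?thesis
    unfolding day_shift_def using assms
    by (simp add: cubes_eval4_apply[OF assms(1,2)] refl_cube_closed refl_cube_apply)
qed

lemma delta_line_day_shift_insert_iff:
  assumes alg: "algebra ar A F" and wf: "wf_trm ar t" and \<gamma>: "\<gamma> \<in> cubes S A"
    and ij: "i \<in> S" "j \<in> S" "i \<noteq> j" and w: "w \<subseteq> S - {i, j}"
  shows "delta_line \<delta> j (day_shift F S i j t \<gamma>) (insert i w) \<longleftrightarrow>
    (eval4 F t (\<gamma> (insert j w)) (\<gamma> w) (\<gamma> (insert i w)) (\<gamma> (insert i (insert j w))),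
     eval4 F t (\<gamma> (insert j w)) (\<gamma> (insert j w))
       (\<gamma> (insert i (insert j w))) (\<gamma> (insert i (insert j w)))) \<in> \<delta>"
proof -
  have "insert i w \<subseteq> S" "insert i (insert j w) \<subseteq> S" using ij w by auto
  moreover have "insert i w - {i} = w" "insert i (insert j w) - {i} = insert j w"
    using ij w by auto
  ultimately show ?thesis
    unfolding delta_line_def
    by (simp add: day_shift_apply[OF alg wf \<gamma> ij(1,2)] insert_commute[of j i])
qed

lemma delta_line_day_shift:
  assumes alg: "algebra ar A F" and \<delta>: "\<delta> \<in> Con ar A F" and t: "t \<in> day_terms ar A F"
    and \<gamma>: "\<gamma> \<in> cubes S A" and ij: "i \<in> S" "j \<in> S" "i \<noteq> j" and u: "u \<subseteq> S - {j}"
    and lines: "i \<in> u \<Longrightarrow> delta_line \<delta> i \<gamma> (u - {i})"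
      "i \<in> u \<Longrightarrow> delta_line \<delta> i \<gamma> (insert j (u - {i}))"
  shows "delta_line \<delta> j (day_shift F S i j t \<gamma>) u"
proof (cases "i \<in> u")
  case True
  then obtain w where w: "u = insert i w" "i \<notin> w" by (rule Set.set_insert)
  have wf: "wf_trm ar t" using t by (simp add: day_terms_def)
  have wS: "w \<subseteq> S - {i, j}" using u w by auto
  have "delta_line \<delta> i \<gamma> w" "delta_line \<delta> i \<gamma> (insert j w)" using lines w by auto
  then show ?thesis
    unfolding w(1) delta_line_day_shift_insert_iff[OF alg wf \<gamma> ij wS]
    by (intro day_terms_rectangle[OF \<delta> t]) (simp_all add: delta_line_def)
next
  case False
  have "u - {i} = u" "insert j u - {i} = insert j u" "u \<subseteq> S" "insert j u \<subseteq> S"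
    using False u ij by auto
  moreover from this have "\<gamma> u \<in> A" "\<gamma> (insert j u) \<in> A" by (simp_all add: cubes_value[OF \<gamma>])
  ultimately show ?thesis
    using t unfolding delta_line_def
    by (simp add: day_shift_apply[OF alg _ \<gamma> ij(1,2)] day_terms_def Con_refl[OF \<delta>])
qed

subsection \<open>Composing cubes along a direction\<close>

definition composable :: "nat set \<Rightarrow> nat \<Rightarrow> (nat set \<Rightarrow> 'a) \<Rightarrow> (nat set \<Rightarrow> 'a) \<Rightarrow> bool" where
  "composable S k \<gamma>\<^sub>1 \<gamma>\<^sub>2 \<longleftrightarrow> face S k True \<gamma>\<^sub>1 = face S k False \<gamma>\<^sub>2"

definition stack :: "nat set \<Rightarrow> nat \<Rightarrow> (nat set \<Rightarrow> 'a) \<Rightarrow> (nat set \<Rightarrow> 'a) \<Rightarrow> nat set \<Rightarrow> 'a" where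
  "stack S k \<gamma>\<^sub>1 \<gamma>\<^sub>2 = glue S k (face S k False \<gamma>\<^sub>1) (face S k True \<gamma>\<^sub>2)"

definition cube_comp :: "nat set \<Rightarrow> nat \<Rightarrow> (nat set \<Rightarrow> 'a) set \<Rightarrow> (nat set \<Rightarrow> 'a) set" where
  "cube_comp S k R = {stack S k \<gamma>\<^sub>1 \<gamma>\<^sub>2 | \<gamma>\<^sub>1 \<gamma>\<^sub>2. \<gamma>\<^sub>1 \<in> R \<and> \<gamma>\<^sub>2 \<in> R \<and> composable S k \<gamma>\<^sub>1 \<gamma>\<^sub>2}"

lemma composable_iff:
  "composable S k \<gamma>\<^sub>1 \<gamma>\<^sub>2 \<longleftrightarrow> (\<forall>u. u \<subseteq> S - {k} \<longrightarrow> \<gamma>\<^sub>1 (insert k u) = \<gamma>\<^sub>2 u)"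
  by (auto simp: composable_def face_def restrict_def fun_eq_iff)

lemma stack_eq_restrict:
  "k \<in> S \<Longrightarrow> stack S k \<gamma>\<^sub>1 \<gamma>\<^sub>2 = (\<lambda>u\<in>Pow S. if k \<in> u then \<gamma>\<^sub>2 u else \<gamma>\<^sub>1 u)"
  unfolding stack_def glue_def face_def by (rule restrict_ext) (auto simp: insert_absorb)

lemma stack_apply: "k \<in> S \<Longrightarrow> u \<subseteq> S \<Longrightarrow> stack S k \<gamma>\<^sub>1 \<gamma>\<^sub>2 u = (if k \<in> u then \<gamma>\<^sub>2 u else \<gamma>\<^sub>1 u)"
  by (simp add: stack_eq_restrict)

lemma stack_closed:
  assumes "k \<in> S" "\<gamma>\<^sub>1 \<in> cubes S A" "\<gamma>\<^sub>2 \<in> cubes S A"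
  shows "stack S k \<gamma>\<^sub>1 \<gamma>\<^sub>2 \<in> cubes S A"
  unfolding stack_eq_restrict[OF assms(1)]
  using assms by (intro restrict_in_cubes) (simp add: cubes_value)

lemma face_glue_face:
  "k \<in> S \<Longrightarrow> face S k j (glue S k (face S k a \<gamma>) (face S k b \<gamma>')) =
    (if j then face S k b \<gamma>' else face S k a \<gamma>)"
proof
  fix u assume k: "k \<in> S"
  show "face S k j (glue S k (face S k a \<gamma>) (face S k b \<gamma>')) u =
      (if j then face S k b \<gamma>' else face S k a \<gamma>) u"
  proof (cases "u \<subseteq> S - {k}")
    case True
    then have "u \<subseteq> S" "insert k u \<subseteq> S" "k \<notin> u" using k by auto
    then show ?thesis using True by (simp add: face_def glue_def)
  qed (simp add: face_def)
qed

lemma face_stack: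
  "k \<in> S \<Longrightarrow> face S k j (stack S k \<gamma>\<^sub>1 \<gamma>\<^sub>2) = face S k j (if j then \<gamma>\<^sub>2 else \<gamma>\<^sub>1)"
  by (simp add: stack_def face_glue_face)

lemma face_sym_cube: "k \<in> S \<Longrightarrow> face S k j (sym_cube S k \<gamma>) = face S k (\<not> j) \<gamma>"
  by (simp add: sym_cube_def face_glue_face)

lemma relcomp_face_rel_subset:
  assumes k: "k \<in> S"
  shows "face_rel S k R O face_rel S k R \<subseteq> face_rel S k (cube_comp S k R)"
proof clarify
  fix x y z assume "(x, y) \<in> face_rel S k R" "(y, z) \<in> face_rel S k R"
  then obtain \<gamma>\<^sub>1 \<gamma>\<^sub>2 where "\<gamma>\<^sub>1 \<in> R" "\<gamma>\<^sub>2 \<in> R" "composable S k \<gamma>\<^sub>1 \<gamma>\<^sub>2"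
    and xz: "x = face S k False \<gamma>\<^sub>1" "z = face S k True \<gamma>\<^sub>2"
    by (auto simp: face_rel_def composable_def)
  then have "stack S k \<gamma>\<^sub>1 \<gamma>\<^sub>2 \<in> cube_comp S k R" unfolding cube_comp_def by blast
  then have "(face S k False (stack S k \<gamma>\<^sub>1 \<gamma>\<^sub>2), face S k True (stack S k \<gamma>\<^sub>1 \<gamma>\<^sub>2))
      \<in> face_rel S k (cube_comp S k R)" unfolding face_rel_def by blast
  then show "(x, z) \<in> face_rel S k (cube_comp S k R)" by (simp add: xz face_stack[OF k])
qed

lemma trans_face_rel:
  assumes k: "k \<in> S" and closed: "cube_comp S k R \<subseteq> R"
  shows "trans (face_rel S k R)"
proof -
  have "face_rel S k (cube_comp S k R) \<subseteq> face_rel S k R"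
    using closed unfolding face_rel_def by blast
  then have "face_rel S k R O face_rel S k R \<subseteq> face_rel S k R"
    using relcomp_face_rel_subset[OF k] by blast
  then show ?thesis by (blast intro: transI)
qed

lemma cube_comp_subset:
  "k \<in> S \<Longrightarrow> R \<subseteq> cubes S A \<Longrightarrow> cube_comp S k R \<subseteq> cubes S A"
  by (auto simp: cube_comp_def intro!: stack_closed)

lemma subset_cube_comp:
  assumes R: "hd_tolerance ar A F S R" and k: "k \<in> S"
  shows "R \<subseteq> cube_comp S k R"
proof
  fix \<gamma> assume \<gamma>: "\<gamma> \<in> R"
  then have "\<gamma> \<in> cubes S A" by (rule hd_tolerance_cubes[OF R])
  then have "\<gamma> = stack S k \<gamma> (refl_cube S k True \<gamma>)"
  proof (rule cubes_eqI)
    show "stack S k \<gamma> (refl_cube S k True \<gamma>) \<in> cubes S A"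
      using k \<open>\<gamma> \<in> cubes S A\<close> by (simp add: stack_closed refl_cube_closed)
    show "\<gamma> u = stack S k \<gamma> (refl_cube S k True \<gamma>) u" if "u \<subseteq> S" for u
      using k that by (simp add: stack_apply refl_cube_apply insert_absorb)
  qed
  moreover have "composable S k \<gamma> (refl_cube S k True \<gamma>)"
    using k by (simp add: composable_def refl_cube_def face_glue_face)
  moreover have "refl_cube S k True \<gamma> \<in> R" using R \<gamma> k by (simp add: hd_tolerance_def)
  ultimately show "\<gamma> \<in> cube_comp S k R" using \<gamma> unfolding cube_comp_def by blast
qed

lemma cube_comp_subuniverse:
  assumes R: "cube_subuniverse ar A F S R" and k: "k \<in> S"
  shows "cube_subuniverse ar A F S (cube_comp S k R)"
  unfolding cube_subuniverse_iff
proof (intro conjI allI impI)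
  show "cube_comp S k R \<subseteq> cubes S A"
    using R k by (simp add: cube_comp_subset cube_subuniverse_iff)
next
  fix f \<gamma>s assume \<gamma>s: "length \<gamma>s = ar f \<and> set \<gamma>s \<subseteq> cube_comp S k R"
  let ?P = "{(\<gamma>\<^sub>1, \<gamma>\<^sub>2). \<gamma>\<^sub>1 \<in> R \<and> \<gamma>\<^sub>2 \<in> R \<and> composable S k \<gamma>\<^sub>1 \<gamma>\<^sub>2}"
  have "cube_comp S k R = (\<lambda>(\<gamma>\<^sub>1, \<gamma>\<^sub>2). stack S k \<gamma>\<^sub>1 \<gamma>\<^sub>2) ` ?P"
    unfolding cube_comp_def by auto
  then have "\<gamma>s \<in> lists ((\<lambda>(\<gamma>\<^sub>1, \<gamma>\<^sub>2). stack S k \<gamma>\<^sub>1 \<gamma>\<^sub>2) ` ?P)" using \<gamma>s by (simp add: lists_eq_set)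
  then obtain ps where ps: "set ps \<subseteq> ?P" and \<gamma>s_eq: "\<gamma>s = map (\<lambda>(\<gamma>\<^sub>1, \<gamma>\<^sub>2). stack S k \<gamma>\<^sub>1 \<gamma>\<^sub>2) ps"
    unfolding lists_image by (auto simp: lists_eq_set)
  let ?\<gamma>\<^sub>1 = "cube_op S F f (map fst ps)" and ?\<gamma>\<^sub>2 = "cube_op S F f (map snd ps)"
  have "set (map fst ps) \<subseteq> R" "set (map snd ps) \<subseteq> R" using ps by auto
  then have "?\<gamma>\<^sub>1 \<in> R" "?\<gamma>\<^sub>2 \<in> R" using R \<gamma>s \<gamma>s_eq by (simp_all add: cube_subuniverse_iff)
  moreover have "composable S k ?\<gamma>\<^sub>1 ?\<gamma>\<^sub>2"
    unfolding composable_iff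
  proof (intro allI impI)
    fix u assume u: "u \<subseteq> S - {k}"
    then have "map (\<lambda>p. fst p (insert k u)) ps = map (\<lambda>p. snd p u) ps"
      using ps by (auto simp: composable_iff)
    moreover have "u \<subseteq> S" "insert k u \<subseteq> S" using u k by auto
    ultimately show "?\<gamma>\<^sub>1 (insert k u) = ?\<gamma>\<^sub>2 u"
      by (simp add: cube_op_apply comp_def del: map_eq_conv)
  qed
  moreover have "cube_op S F f \<gamma>s = stack S k ?\<gamma>\<^sub>1 ?\<gamma>\<^sub>2"
    unfolding stack_eq_restrict[OF k] unfolding cube_op_def
    by (rule restrict_ext) (simp add: \<gamma>s_eq stack_apply[OF k] comp_def split_beta)
  ultimately show "cube_op S F f \<gamma>s \<in> cube_comp S k R" unfolding cube_comp_def by blast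
qed

lemma composable_act_cube:
  assumes comp: "composable S k \<gamma>\<^sub>1 \<gamma>\<^sub>2" and ik: "i \<in> S" "k \<in> S" "i \<noteq> k"
  shows "composable S k (act_cube S i \<phi> \<gamma>\<^sub>1) (act_cube S i \<phi> \<gamma>\<^sub>2)"
  unfolding composable_iff
proof (intro allI impI)
  fix u assume u: "u \<subseteq> S - {k}"
  have "act_coord i \<phi> (insert k u) = insert k (act_coord i \<phi> u)"
    using ik by (auto simp: act_coord_def)
  moreover have "act_coord i \<phi> u \<subseteq> S - {k}" using u ik by (auto simp: act_coord_def)
  moreover have "u \<subseteq> S" "insert k u \<subseteq> S" using u ik by auto
  ultimately show "act_cube S i \<phi> \<gamma>\<^sub>1 (insert k u) = act_cube S i \<phi> \<gamma>\<^sub>2 u"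
    using comp by (simp add: act_cube_apply composable_iff)
qed

lemma act_cube_stack:
  assumes "i \<in> S" "k \<in> S" "i \<noteq> k"
  shows "act_cube S i \<phi> (stack S k \<gamma>\<^sub>1 \<gamma>\<^sub>2) = stack S k (act_cube S i \<phi> \<gamma>\<^sub>1) (act_cube S i \<phi> \<gamma>\<^sub>2)"
  unfolding act_cube_def stack_eq_restrict[OF assms(2)]
  by (rule restrict_ext) (simp add: act_coord_subset mem_act_coord_iff assms assms(3)[symmetric])

lemma cube_comp_refl_sym_same_direction:
  assumes R: "hd_tolerance ar A F S R" and k: "k \<in> S" and "\<gamma> \<in> cube_comp S k R"
  shows "refl_cube S k j \<gamma> \<in> cube_comp S k R" and "sym_cube S k \<gamma> \<in> cube_comp S k R"
proof -
  obtain \<gamma>\<^sub>1 \<gamma>\<^sub>2 where \<gamma>R: "\<gamma>\<^sub>1 \<in> R" "\<gamma>\<^sub>2 \<in> R" and comp: "composable S k \<gamma>\<^sub>1 \<gamma>\<^sub>2"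
    and \<gamma>: "\<gamma> = stack S k \<gamma>\<^sub>1 \<gamma>\<^sub>2"
    using \<open>\<gamma> \<in> cube_comp S k R\<close> unfolding cube_comp_def by blast
  have "refl_cube S k j \<gamma> = refl_cube S k j (if j then \<gamma>\<^sub>2 else \<gamma>\<^sub>1)"
    by (simp add: \<gamma> refl_cube_def face_stack[OF k])
  then have "refl_cube S k j \<gamma> \<in> R" using R \<gamma>R k by (simp add: hd_tolerance_def)
  then show "refl_cube S k j \<gamma> \<in> cube_comp S k R" using subset_cube_comp[OF R k] by blast
  have "sym_cube S k \<gamma> = stack S k (sym_cube S k \<gamma>\<^sub>2) (sym_cube S k \<gamma>\<^sub>1)"
    by (simp add: \<gamma> stack_def sym_cube_def face_glue_face[OF k])
  moreover have "composable S k (sym_cube S k \<gamma>\<^sub>2) (sym_cube S k \<gamma>\<^sub>1)"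
    using comp by (simp add: composable_def face_sym_cube[OF k])
  moreover have "sym_cube S k \<gamma>\<^sub>2 \<in> R" "sym_cube S k \<gamma>\<^sub>1 \<in> R"
    using R \<gamma>R k by (simp_all add: hd_tolerance_def)
  ultimately show "sym_cube S k \<gamma> \<in> cube_comp S k R" unfolding cube_comp_def by blast
qed

lemma cube_comp_act_cube_other_direction:
  assumes R: "hd_tolerance ar A F S R" and i: "i \<in> S" "k \<in> S" "i \<noteq> k" and "\<gamma> \<in> cube_comp S k R"
  shows "act_cube S i \<phi> \<gamma> \<in> cube_comp S k R"
proof -
  obtain \<gamma>\<^sub>1 \<gamma>\<^sub>2 where \<gamma>R: "\<gamma>\<^sub>1 \<in> R" "\<gamma>\<^sub>2 \<in> R" and comp: "composable S k \<gamma>\<^sub>1 \<gamma>\<^sub>2"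
    and \<gamma>: "\<gamma> = stack S k \<gamma>\<^sub>1 \<gamma>\<^sub>2"
    using \<open>\<gamma> \<in> cube_comp S k R\<close> unfolding cube_comp_def by blast
  have "act_cube S i \<phi> \<gamma>\<^sub>1 \<in> R" "act_cube S i \<phi> \<gamma>\<^sub>2 \<in> R"
    using R \<gamma>R i(1) by (simp_all add: hd_tolerance_iff)
  then show ?thesis
    using composable_act_cube[OF comp i] act_cube_stack[OF i] unfolding \<gamma> cube_comp_def by blast
qed

lemma cube_comp_tolerance:
  assumes R: "hd_tolerance ar A F S R" and k: "k \<in> S"
  shows "hd_tolerance ar A F S (cube_comp S k R)"
  unfolding hd_tolerance_def
proof (intro conjI ballI allI)
  show "cube_subuniverse ar A F S (cube_comp S k R)"
    using R k by (simp add: cube_comp_subuniverse hd_tolerance_def)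
next
  fix \<gamma> i j assume \<gamma>: "\<gamma> \<in> cube_comp S k R" and i: "i \<in> S"
  show "refl_cube S i j \<gamma> \<in> cube_comp S k R"
    using cube_comp_refl_sym_same_direction(1)[OF R k \<gamma>]
      cube_comp_act_cube_other_direction[OF R i k _ \<gamma>]
    by (cases "i = k") (simp_all add: refl_cube_eq_act_cube[OF i])
  show "sym_cube S i \<gamma> \<in> cube_comp S k R"
    using cube_comp_refl_sym_same_direction(2)[OF R k \<gamma>]
      cube_comp_act_cube_other_direction[OF R i k _ \<gamma>]
    by (cases "i = k") (simp_all add: sym_cube_eq_act_cube[OF i])
qed

subsection \<open>Lines of composable cubes\<close>

lemma composable_day_shift:
  assumes alg: "algebra ar A F" and wf: "wf_trm ar t" and comp: "composable S k \<gamma>\<^sub>1 \<gamma>\<^sub>2"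
    and \<gamma>: "\<gamma>\<^sub>1 \<in> cubes S A" "\<gamma>\<^sub>2 \<in> cubes S A"
    and ijk: "i \<in> S" "j \<in> S" "k \<in> S" "i \<noteq> k" "j \<noteq> k"
  shows "composable S k (day_shift F S i j t \<gamma>\<^sub>1) (day_shift F S i j t \<gamma>\<^sub>2)"
  unfolding composable_iff
proof (intro allI impI)
  fix u assume u: "u \<subseteq> S - {k}"
  have match: "\<gamma>\<^sub>1 (insert k v) = \<gamma>\<^sub>2 v" if "v \<subseteq> S - {k}" for v
    using comp that by (simp add: composable_iff)
  have "u \<subseteq> S" "insert k u \<subseteq> S" "insert k u - {i} = insert k (u - {i})"
    "\<And>v. insert j (insert k v) = insert k (insert j v)"
    "u - {i} \<subseteq> S - {k}" "insert j u \<subseteq> S - {k}" "insert j (u - {i}) \<subseteq> S - {k}"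
    using u ijk by auto
  then show "day_shift F S i j t \<gamma>\<^sub>1 (insert k u) = day_shift F S i j t \<gamma>\<^sub>2 u"
    using u by (simp add: day_shift_apply[OF alg wf _ ijk(1,2)] \<gamma> match)
qed

lemma delta_line_composable:
  assumes "composable S k \<gamma>\<^sub>1 \<gamma>\<^sub>2" "i \<in> S" "i \<noteq> k" "u \<subseteq> S - {i, k}"
  shows "delta_line \<delta> i \<gamma>\<^sub>1 (insert k u) \<longleftrightarrow> delta_line \<delta> i \<gamma>\<^sub>2 u"
proof -
  have "u \<subseteq> S - {k}" "insert i u \<subseteq> S - {k}" using assms by auto
  then show ?thesis
    using assms(1) by (simp add: delta_line_def composable_iff insert_commute[of i k])
qed

lemma central_at_pivot_line:
  assumes central: "central_at S \<delta> i R" and "\<gamma> \<in> R" and ik: "i \<in> S" "k \<in> S" "i \<noteq> k"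
    and bottom: "\<And>u. u \<subseteq> S - {i, k} \<Longrightarrow> delta_line \<delta> i \<gamma> u"
    and top: "\<And>u. u \<subset> S - {i, k} \<Longrightarrow> delta_line \<delta> i \<gamma> (insert k u)"
  shows "delta_line \<delta> i \<gamma> (S - {i})"
proof -
  have "delta_line \<delta> i \<gamma> u" if u: "u \<subset> S - {i}" for u
  proof (cases "k \<in> u")
    case True
    then have "u - {k} \<subset> S - {i, k}" "insert k (u - {k}) = u" using u ik by auto
    then show ?thesis using top[of "u - {k}"] by simp
  next
    case False
    then show ?thesis using u by (intro bottom) auto
  qed
  then show ?thesis using central \<open>\<gamma> \<in> R\<close> unfolding central_at_iff[OF ik(1)] by blast
qed

text \<open>The two cubes form three layers in direction \<open>k\<close>, the middle one being shared, and \<open>V\<close> bounds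
  from below the places where an \<open>i\<close>-line of the middle layer may fail to be a \<open>\<delta>\<close>-pair.\<close>
definition confined_failures ::
  "'a rel \<Rightarrow> nat set \<Rightarrow> nat \<Rightarrow> nat \<Rightarrow> nat set \<Rightarrow> (nat set \<Rightarrow> 'a) \<Rightarrow> (nat set \<Rightarrow> 'a) \<Rightarrow> bool" where
  "confined_failures \<delta> S k i V \<gamma>\<^sub>1 \<gamma>\<^sub>2 \<longleftrightarrow>
     (\<forall>u. u \<subseteq> S - {i, k} \<longrightarrow> delta_line \<delta> i \<gamma>\<^sub>1 u) \<and>
     (\<forall>u. u \<subseteq> S - {i, k} \<and> \<not> V \<subseteq> u \<longrightarrow> delta_line \<delta> i \<gamma>\<^sub>2 u) \<and>
     (\<forall>u. u \<subset> S - {i, k} \<longrightarrow> delta_line \<delta> i \<gamma>\<^sub>2 (insert k u))"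

lemma confined_failures_pivot_line:
  assumes central: "central_at S \<delta> i R" and R: "\<gamma>\<^sub>1 \<in> R" "\<gamma>\<^sub>2 \<in> R"
    and comp: "composable S k \<gamma>\<^sub>1 \<gamma>\<^sub>2" and ik: "i \<in> S" "k \<in> S" "i \<noteq> k"
    and confined: "confined_failures \<delta> S k i V \<gamma>\<^sub>1 \<gamma>\<^sub>2" and V: "S - {i, k} \<subseteq> V"
  shows "delta_line \<delta> i \<gamma>\<^sub>2 (S - {i})"
proof -
  have bottom: "delta_line \<delta> i \<gamma>\<^sub>1 u" if "u \<subseteq> S - {i, k}" for u
    using confined that by (simp add: confined_failures_def)
  have middle: "delta_line \<delta> i \<gamma>\<^sub>2 u" if "u \<subset> S - {i, k}" for u
  proof -
    have "\<not> V \<subseteq> u" using V that by auto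
    then show ?thesis using confined that by (auto simp: confined_failures_def)
  qed
  have top: "delta_line \<delta> i \<gamma>\<^sub>2 (insert k u)" if "u \<subset> S - {i, k}" for u
    using confined that by (simp add: confined_failures_def)
  note pivot = central_at_pivot_line[OF central _ ik]
  have "delta_line \<delta> i \<gamma>\<^sub>1 (S - {i})"
  proof (rule pivot[OF R(1) bottom])
    fix u assume u: "u \<subset> S - {i, k}"
    then have "u \<subseteq> S - {i, k}" by auto
    then show "delta_line \<delta> i \<gamma>\<^sub>1 (insert k u)"
      using middle[OF u] by (simp add: delta_line_composable[OF comp ik(1,3)])
  qed
  moreover have "S - {i} = insert k (S - {i, k})" using ik by auto
  ultimately have "delta_line \<delta> i \<gamma>\<^sub>2 (S - {i, k})"
    using delta_line_composable[OF comp ik(1,3) subset_refl] by metis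
  then have "delta_line \<delta> i \<gamma>\<^sub>2 u" if "u \<subseteq> S - {i, k}" for u
    using middle that by (cases "u = S - {i, k}") auto
  then show ?thesis using top by (rule pivot[OF R(2)])
qed

lemma confined_failures_day_shift:
  assumes alg: "algebra ar A F" and \<delta>: "\<delta> \<in> Con ar A F" and t: "t \<in> day_terms ar A F"
    and \<gamma>: "\<gamma>\<^sub>1 \<in> cubes S A" "\<gamma>\<^sub>2 \<in> cubes S A"
    and ijk: "i \<in> S" "j \<in> S" "k \<in> S" "i \<noteq> j" "i \<noteq> k" "j \<noteq> k" and "j \<notin> V"
    and confined: "confined_failures \<delta> S k i V \<gamma>\<^sub>1 \<gamma>\<^sub>2"
  shows "confined_failures \<delta> S k j (insert i V) (day_shift F S i j t \<gamma>\<^sub>1) (day_shift F S i j t \<gamma>\<^sub>2)"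
  unfolding confined_failures_def
proof (intro conjI allI impI)
  note shift = delta_line_day_shift[OF alg \<delta> t _ ijk(1,2,4)]
  show "delta_line \<delta> j (day_shift F S i j t \<gamma>\<^sub>1) u" if u: "u \<subseteq> S - {j, k}" for u
  proof (rule shift[OF \<gamma>(1)])
    show "u \<subseteq> S - {j}" using u by auto
    have "u - {i} \<subseteq> S - {i, k}" "insert j (u - {i}) \<subseteq> S - {i, k}" using u ijk by auto
    then show "delta_line \<delta> i \<gamma>\<^sub>1 (u - {i})" "delta_line \<delta> i \<gamma>\<^sub>1 (insert j (u - {i}))"
      using confined by (simp_all add: confined_failures_def)
  qed
  show "delta_line \<delta> j (day_shift F S i j t \<gamma>\<^sub>2) u"
    if u: "u \<subseteq> S - {j, k} \<and> \<not> insert i V \<subseteq> u" for u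
  proof (rule shift[OF \<gamma>(2)])
    show "u \<subseteq> S - {j}" using u by auto
    assume "i \<in> u"
    then have "\<not> V \<subseteq> u - {i}" "\<not> V \<subseteq> insert j (u - {i})" using u \<open>j \<notin> V\<close> by auto
    moreover have "u - {i} \<subseteq> S - {i, k}" "insert j (u - {i}) \<subseteq> S - {i, k}" using u ijk by auto
    ultimately show "delta_line \<delta> i \<gamma>\<^sub>2 (u - {i})" "delta_line \<delta> i \<gamma>\<^sub>2 (insert j (u - {i}))"
      using confined by (simp_all add: confined_failures_def)
  qed
  show "delta_line \<delta> j (day_shift F S i j t \<gamma>\<^sub>2) (insert k u)" if u: "u \<subset> S - {j, k}" for u
  proof (rule shift[OF \<gamma>(2)])
    show "insert k u \<subseteq> S - {j}" using u ijk by auto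
    assume "i \<in> insert k u"
    then have "u - {i} \<subset> S - {i, k}" "insert j (u - {i}) \<subset> S - {i, k}" using u ijk by auto
    moreover have "insert k u - {i} = insert k (u - {i})" using ijk by auto
    ultimately show "delta_line \<delta> i \<gamma>\<^sub>2 (insert k u - {i})"
      "delta_line \<delta> i \<gamma>\<^sub>2 (insert j (insert k u - {i}))"
      using confined by (simp_all add: confined_failures_def insert_commute[of j k])
  qed
qed

subsection \<open>Centrality in a congruence modular variety\<close>

lemma central_mono: "central S \<delta> R \<Longrightarrow> Q \<subseteq> R \<Longrightarrow> central S \<delta> Q"
  unfolding central_def central_at_def by blast

lemma central_Union: "(\<And>C. C \<in> \<C> \<Longrightarrow> central S \<delta> C) \<Longrightarrow> central S \<delta> (\<Union>\<C>)"
  unfolding central_def central_at_def by blast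

lemma hd_tolerance_Union_chain:
  assumes \<C>: "\<C> \<noteq> {}" "subset.chain \<A> \<C>" and tolerance: "\<And>C. C \<in> \<C> \<Longrightarrow> hd_tolerance ar A F S C"
  shows "hd_tolerance ar A F S (\<Union>\<C>)"
proof -
  have subuniverse: "cube_subuniverse ar A F S C" if "C \<in> \<C>" for C
    using tolerance[OF that] by (simp add: hd_tolerance_def)
  have "cube_subuniverse ar A F S (\<Union>\<C>)"
    unfolding cube_subuniverse_iff
  proof (intro conjI allI impI)
    show "\<Union>\<C> \<subseteq> cubes S A" using subuniverse by (auto simp: cube_subuniverse_iff)
    fix f \<gamma>s assume \<gamma>s: "length \<gamma>s = ar f \<and> set \<gamma>s \<subseteq> \<Union>\<C>"
    then obtain C where C: "C \<in> \<C>" "set \<gamma>s \<subseteq> C"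
      using finite_subset_Union_chain[OF finite_set _ \<C>] by blast
    then have "cube_op S F f \<gamma>s \<in> C"
      using subuniverse[OF C(1)] \<gamma>s by (simp add: cube_subuniverse_iff)
    then show "cube_op S F f \<gamma>s \<in> \<Union>\<C>" using C(1) by blast
  qed
  then show ?thesis using tolerance unfolding hd_tolerance_def by blast
qed

context
  fixes ar :: "'f \<Rightarrow> nat" and A :: "'a set" and F :: "'f \<Rightarrow> 'a list \<Rightarrow> 'a"
    and S :: "nat set" and \<delta> :: "'a rel"
  assumes alg: "algebra ar A F" and cm: "in_CM_variety ar A F" and \<delta>: "\<delta> \<in> Con ar A F"
begin

lemma day_shift_reflects_delta_line:
  assumes \<gamma>: "\<gamma> \<in> cubes S A" and ij: "i \<in> S" "j \<in> S" "i \<noteq> j" and w: "w \<subseteq> S - {i, j}"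
    and line: "delta_line \<delta> i \<gamma> w"
    and shifts: "\<And>t. t \<in> day_terms ar A F \<Longrightarrow>
      delta_line \<delta> j (day_shift F S i j t \<gamma>) (insert i w)"
  shows "delta_line \<delta> i \<gamma> (insert j w)"
  unfolding delta_line_def
proof (rule day_terms_separate[OF alg cm \<delta>])
  show "\<gamma> (insert j w) \<in> A" "\<gamma> (insert i (insert j w)) \<in> A"
    using ij w by (auto intro: cubes_value[OF \<gamma>])
  show "(\<gamma> w, \<gamma> (insert i w)) \<in> \<delta>" using line by (simp add: delta_line_def)
  fix t assume "t \<in> day_terms ar A F"
  then show "(eval4 F t (\<gamma> (insert j w)) (\<gamma> w) (\<gamma> (insert i w)) (\<gamma> (insert i (insert j w))),
      eval4 F t (\<gamma> (insert j w)) (\<gamma> (insert j w))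
        (\<gamma> (insert i (insert j w))) (\<gamma> (insert i (insert j w)))) \<in> \<delta>"
    using shifts delta_line_day_shift_insert_iff[OF alg _ \<gamma> ij w] by (simp add: day_terms_def)
qed

lemma pivot_line_if_day_shifts:
  assumes \<gamma>: "\<gamma> \<in> cubes S A" and ij: "i \<in> S" "j \<in> S" "i \<noteq> j"
    and line: "delta_line \<delta> i \<gamma> (S - {i, j})"
    and shifts: "\<And>t. t \<in> day_terms ar A F \<Longrightarrow> delta_line \<delta> j (day_shift F S i j t \<gamma>) (S - {j})"
  shows "delta_line \<delta> i \<gamma> (S - {i})"
proof -
  have directions: "insert j (S - {i, j}) = S - {i}" "insert i (S - {i, j}) = S - {j}"
    using ij by auto
  have "delta_line \<delta> i \<gamma> (insert j (S - {i, j}))"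
    using shifts
    by (intro day_shift_reflects_delta_line[OF \<gamma> ij subset_refl line]) (simp only: directions)
  then show ?thesis by (simp only: directions)
qed

lemma central_at_change_direction:
  assumes R: "hd_tolerance ar A F S R" and ij: "i \<in> S" "j \<in> S" "i \<noteq> j"
    and central: "central_at S \<delta> j R"
  shows "central_at S \<delta> i R"
  unfolding central_at_iff[OF ij(1)]
proof (intro ballI impI)
  fix \<gamma> assume "\<gamma> \<in> R" and supporting: "\<forall>u. u \<subset> S - {i} \<longrightarrow> delta_line \<delta> i \<gamma> u"
  have \<gamma>: "\<gamma> \<in> cubes S A" using R \<open>\<gamma> \<in> R\<close> by (rule hd_tolerance_cubes)
  show "delta_line \<delta> i \<gamma> (S - {i})"
  proof (rule pivot_line_if_day_shifts[OF \<gamma> ij])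
    have "S - {i, j} \<subset> S - {i}" using ij by auto
    then show "delta_line \<delta> i \<gamma> (S - {i, j})" using supporting by blast
  next
    fix t assume t: "t \<in> day_terms ar A F"
    have "delta_line \<delta> j (day_shift F S i j t \<gamma>) u" if u: "u \<subset> S - {j}" for u
    proof (rule delta_line_day_shift[OF alg \<delta> t \<gamma> ij])
      show "u \<subseteq> S - {j}" using u by auto
      assume "i \<in> u"
      then have "u - {i} \<subset> S - {i}" "insert j (u - {i}) \<subset> S - {i}" using u ij by auto
      then show "delta_line \<delta> i \<gamma> (u - {i})" "delta_line \<delta> i \<gamma> (insert j (u - {i}))"
        using supporting by blast+
    qed
    moreover have "day_shift F S i j t \<gamma> \<in> R"
      using R \<open>\<gamma> \<in> R\<close> ij(1,2) t by (intro day_shift_closed) (auto simp: day_terms_def)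
    ultimately show "delta_line \<delta> j (day_shift F S i j t \<gamma>) (S - {j})"
      using central unfolding central_at_iff[OF ij(2)] by blast
  qed
qed

text \<open>A shift from \<open>i\<close> to a direction \<open>j\<close> outside \<open>V\<close> adds \<open>i\<close> to \<open>V\<close>; once \<open>V\<close> contains all
  directions but \<open>i\<close> and \<open>k\<close>, centrality applies to the first cube and then to the second.\<close>
lemma composable_pivot_line:
  assumes R: "hd_tolerance ar A F S R" and central: "central S \<delta> R" and "finite S" and k: "k \<in> S"
    and "i \<in> S" "i \<noteq> k" "\<gamma>\<^sub>1 \<in> R" "\<gamma>\<^sub>2 \<in> R" "composable S k \<gamma>\<^sub>1 \<gamma>\<^sub>2"
    and "confined_failures \<delta> S k i V \<gamma>\<^sub>1 \<gamma>\<^sub>2"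
  shows "delta_line \<delta> i \<gamma>\<^sub>2 (S - {i})"
  using assms(5-)
proof (induction "card (S - {i, k} - V)" arbitrary: i V \<gamma>\<^sub>1 \<gamma>\<^sub>2 rule: less_induct)
  case less
  note i = less.prems(1,2) and \<gamma>R = less.prems(3,4) and comp = less.prems(5)
    and confined = less.prems(6)
  show ?case
  proof (cases "S - {i, k} \<subseteq> V")
    case True
    have "central_at S \<delta> i R" using central i by (simp add: central_def)
    then show ?thesis using \<gamma>R comp i(1) k i(2) confined True by (rule confined_failures_pivot_line)
  next
    case False
    then obtain j where j: "j \<in> S" "i \<noteq> j" "j \<noteq> k" "j \<notin> V" by blast
    have \<gamma>: "\<gamma>\<^sub>1 \<in> cubes S A" "\<gamma>\<^sub>2 \<in> cubes S A" using \<gamma>R by (auto intro: hd_tolerance_cubes[OF R])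
    show ?thesis
    proof (rule pivot_line_if_day_shifts[OF \<gamma>(2) i(1) j(1,2)])
      have "S - {i, k, j} \<subset> S - {i, k}" "S - {i, j} = insert k (S - {i, k, j})"
        using i j k by auto
      then show "delta_line \<delta> i \<gamma>\<^sub>2 (S - {i, j})" using confined by (simp add: confined_failures_def)
    next
      fix t assume t: "t \<in> day_terms ar A F"
      then have wf: "wf_trm ar t" by (simp add: day_terms_def)
      let ?T = "day_shift F S i j t"
      have "S - {j, k} - insert i V \<subset> S - {i, k} - V" using i j by auto
      then have "card (S - {j, k} - insert i V) < card (S - {i, k} - V)"
        using \<open>finite S\<close> by (intro psubset_card_mono) auto
      moreover have "?T \<gamma>\<^sub>1 \<in> R" "?T \<gamma>\<^sub>2 \<in> R"
        using \<gamma>R by (simp_all add: day_shift_closed[OF R _ i(1) j(1) wf])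
      moreover have "composable S k (?T \<gamma>\<^sub>1) (?T \<gamma>\<^sub>2)"
        using comp \<gamma> i(1) j(1) k i(2) j(3) by (rule composable_day_shift[OF alg wf])
      moreover have "confined_failures \<delta> S k j (insert i V) (?T \<gamma>\<^sub>1) (?T \<gamma>\<^sub>2)"
        using \<gamma> i(1) j(1) k j(2) i(2) j(3,4) confined
        by (rule confined_failures_day_shift[OF alg \<delta> t])
      ultimately show "delta_line \<delta> j (?T \<gamma>\<^sub>2) (S - {j})" by (intro less.hyps[OF _ j(1,3)])
    qed
  qed
qed

lemma cube_comp_central_at_other:
  assumes R: "hd_tolerance ar A F S R" and central: "central S \<delta> R" and "finite S"
    and k: "k \<in> S" and i: "i \<in> S" "i \<noteq> k"
  shows "central_at S \<delta> i (cube_comp S k R)"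
  unfolding central_at_iff[OF i(1)]
proof (intro ballI impI)
  fix \<gamma> assume "\<gamma> \<in> cube_comp S k R"
    and supporting: "\<forall>u. u \<subset> S - {i} \<longrightarrow> delta_line \<delta> i \<gamma> u"
  then obtain \<gamma>\<^sub>1 \<gamma>\<^sub>2 where \<gamma>R: "\<gamma>\<^sub>1 \<in> R" "\<gamma>\<^sub>2 \<in> R" and comp: "composable S k \<gamma>\<^sub>1 \<gamma>\<^sub>2"
    and \<gamma>: "\<gamma> = stack S k \<gamma>\<^sub>1 \<gamma>\<^sub>2"
    unfolding cube_comp_def by blast
  have line: "delta_line \<delta> i \<gamma> u \<longleftrightarrow> delta_line \<delta> i (if k \<in> u then \<gamma>\<^sub>2 else \<gamma>\<^sub>1) u"
    if "u \<subseteq> S - {i}" for u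
  proof -
    have "u \<subseteq> S" "insert i u \<subseteq> S" "k \<in> insert i u \<longleftrightarrow> k \<in> u" using that i by auto
    then show ?thesis by (simp add: delta_line_def \<gamma> stack_apply[OF k])
  qed
  have "confined_failures \<delta> S k i {} \<gamma>\<^sub>1 \<gamma>\<^sub>2"
    unfolding confined_failures_def
  proof (intro conjI allI impI)
    show "delta_line \<delta> i \<gamma>\<^sub>1 u" if u: "u \<subseteq> S - {i, k}" for u
    proof -
      have "u \<subset> S - {i}" "k \<notin> u" using u i k by auto
      then show ?thesis using supporting line[of u] by auto
    qed
    show "delta_line \<delta> i \<gamma>\<^sub>2 (insert k u)" if u: "u \<subset> S - {i, k}" for u
    proof -
      have "insert k u \<subset> S - {i}" using u i k by auto
      then show ?thesis using supporting line[of "insert k u"] by auto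
    qed
  qed simp
  with R central \<open>finite S\<close> k i \<gamma>R comp have "delta_line \<delta> i \<gamma>\<^sub>2 (S - {i})"
    by (rule composable_pivot_line)
  then show "delta_line \<delta> i \<gamma> (S - {i})" using line[OF subset_refl] k i by simp
qed

lemma cube_comp_central:
  assumes R: "hd_tolerance ar A F S R" and central: "central S \<delta> R" and "finite S"
    and k: "k \<in> S" and "S \<noteq> {k}"
  shows "central S \<delta> (cube_comp S k R)"
  unfolding central_def
proof
  note other = cube_comp_central_at_other[OF R central \<open>finite S\<close> k]
  fix i assume i: "i \<in> S"
  show "central_at S \<delta> i (cube_comp S k R)"
  proof (cases "i = k")
    case True
    obtain j where j: "j \<in> S" "j \<noteq> k" using k \<open>S \<noteq> {k}\<close> by blast
    show ?thesis
      unfolding True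
      using cube_comp_tolerance[OF R k] k j(1) j(2)[symmetric] other[OF j]
      by (rule central_at_change_direction)
  qed (rule other[OF i])
qed

lemma central_hd_congruence_above:
  assumes M: "hd_tolerance ar A F S M" "central S \<delta> M" and "finite S" and S: "\<And>k. S \<noteq> {k}"
  obtains R where "hd_congruence ar A F S R" "central S \<delta> R" "M \<subseteq> R"
proof -
  define \<A> where "\<A> = {R. hd_tolerance ar A F S R \<and> central S \<delta> R \<and> M \<subseteq> R}"
  have "\<exists>R\<in>\<A>. \<forall>X\<in>\<A>. R \<subseteq> X \<longrightarrow> X = R"
  proof (rule subset_Zorn_nonempty)
    show "\<A> \<noteq> {}" using M by (auto simp: \<A>_def)
  next
    fix \<C> assume \<C>: "\<C> \<noteq> {}" "subset.chain \<A> \<C>"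
    then have \<C>\<A>: "hd_tolerance ar A F S C \<and> central S \<delta> C \<and> M \<subseteq> C" if "C \<in> \<C>" for C
      using that by (auto simp: \<A>_def subset.chain_def)
    have "hd_tolerance ar A F S (\<Union>\<C>)" using \<C>\<A> by (intro hd_tolerance_Union_chain[OF \<C>]) simp
    moreover have "central S \<delta> (\<Union>\<C>)" using \<C>\<A> by (intro central_Union) simp
    moreover have "M \<subseteq> \<Union>\<C>" using \<C>\<A> \<C>(1) by blast
    ultimately show "\<Union>\<C> \<in> \<A>" by (simp add: \<A>_def)
  qed
  then obtain R where "R \<in> \<A>" and maximal: "\<And>X. X \<in> \<A> \<Longrightarrow> R \<subseteq> X \<Longrightarrow> X = R" by blast
  then have R: "hd_tolerance ar A F S R" "central S \<delta> R" "M \<subseteq> R" by (auto simp: \<A>_def)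
  have "trans (face_rel S k R)" if k: "k \<in> S" for k
  proof (rule trans_face_rel[OF k])
    have sub: "R \<subseteq> cube_comp S k R" using R(1) k by (rule subset_cube_comp)
    then have "cube_comp S k R \<in> \<A>"
      using R(3) cube_comp_tolerance[OF R(1) k] cube_comp_central[OF R(1,2) \<open>finite S\<close> k S]
      by (auto simp: \<A>_def)
    then show "cube_comp S k R \<subseteq> R" using maximal sub by blast
  qed
  then have "hd_congruence ar A F S R" using R(1) by (simp add: hd_congruence_def)
  then show thesis using R(2,3) that by blast
qed

end

subsection \<open>The two commutators\<close>

lemma cube_k_in_M_rel: "k \<in> S \<Longrightarrow> (x, y) \<in> \<theta> k \<Longrightarrow> cube_k S k x y \<in> M_rel ar A F S \<theta>"
  unfolding M_rel_def by blast

lemma M_rel_least: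
  "cube_subuniverse ar A F S R \<Longrightarrow> (\<And>k x y. k \<in> S \<Longrightarrow> (x, y) \<in> \<theta> k \<Longrightarrow> cube_k S k x y \<in> R) \<Longrightarrow>
    M_rel ar A F S \<theta> \<subseteq> R"
  unfolding M_rel_def by blast

lemma M_rel_subuniverse:
  assumes alg: "algebra ar A F" and \<theta>: "\<And>k. k \<in> S \<Longrightarrow> \<theta> k \<subseteq> A \<times> A"
  shows "cube_subuniverse ar A F S (M_rel ar A F S \<theta>)"
proof -
  have "cube_k S k x y \<in> cubes S A" if "k \<in> S" "(x, y) \<in> \<theta> k" for k x y
    unfolding cube_k_def using \<theta>[OF that(1)] that(2) by (intro restrict_in_cubes) auto
  then have "M_rel ar A F S \<theta> \<subseteq> cubes S A"
    by (intro M_rel_least cube_subuniverse_cubes[OF alg])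
  moreover have "cube_op S F f \<gamma>s \<in> M_rel ar A F S \<theta>"
    if "length \<gamma>s = ar f" "set \<gamma>s \<subseteq> M_rel ar A F S \<theta>" for f \<gamma>s
    unfolding M_rel_def
  proof (rule InterI, elim CollectE conjE)
    fix R assume R: "cube_subuniverse ar A F S R" "\<forall>k\<in>S. \<forall>(x, y)\<in>\<theta> k. cube_k S k x y \<in> R"
    then have "M_rel ar A F S \<theta> \<subseteq> R" by (intro M_rel_least) auto
    then show "cube_op S F f \<gamma>s \<in> R" using R(1) that by (auto simp: cube_subuniverse_iff)
  qed
  ultimately show ?thesis by (simp add: cube_subuniverse_iff)
qed

lemma act_cube_cube_k:
  assumes "i \<in> S"
  shows "act_cube S i \<phi> (cube_k S k x y) =
    (if k = i then cube_k S k (if \<phi> False then y else x) (if \<phi> True then y else x)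
     else cube_k S k x y)"
  (is "?lhs = ?rhs")
proof
  show "?lhs u = ?rhs u" for u
    by (cases "i \<in> u")
      (simp_all add: act_cube_def cube_k_def mem_act_coord_iff act_coord_subset[OF assms])
qed

lemma M_rel_tolerance:
  assumes alg: "algebra ar A F" and \<theta>: "\<And>k. k \<in> S \<Longrightarrow> \<theta> k \<in> Con ar A F"
  shows "hd_tolerance ar A F S (M_rel ar A F S \<theta>)"
proof -
  let ?M = "M_rel ar A F S \<theta>"
  have M: "cube_subuniverse ar A F S ?M" using alg \<theta> by (intro M_rel_subuniverse Con_subset)
  have "?M \<subseteq> {\<gamma> \<in> ?M. act_cube S i \<phi> \<gamma> \<in> ?M}" if i: "i \<in> S" for i \<phi>
  proof (rule M_rel_least[OF cube_subuniverse_vimage_act_cube[OF M i]])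
    fix k x y assume k: "k \<in> S" and xy: "(x, y) \<in> \<theta> k"
    have "(y, x) \<in> \<theta> k" using xy by (rule Con_sym[OF \<theta>[OF k]])
    moreover have "(x, x) \<in> \<theta> k" "(y, y) \<in> \<theta> k"
      using xy Con_subset[OF \<theta>[OF k]] by (auto intro: Con_refl[OF \<theta>[OF k]])
    ultimately show "cube_k S k x y \<in> {\<gamma> \<in> ?M. act_cube S i \<phi> \<gamma> \<in> ?M}"
      using xy k by (cases "k = i") (auto simp: act_cube_cube_k[OF i] intro!: cube_k_in_M_rel)
  qed
  then show ?thesis using M unfolding hd_tolerance_iff by blast
qed

lemma central_M_rel_iff_central_Delta_rel:
  assumes alg: "algebra ar A F" and cm: "in_CM_variety ar A F" and \<delta>: "\<delta> \<in> Con ar A F"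
    and S: "finite S" "\<And>k. S \<noteq> {k}" and \<theta>: "\<And>k. k \<in> S \<Longrightarrow> \<theta> k \<in> Con ar A F"
  shows "central S \<delta> (M_rel ar A F S \<theta>) \<longleftrightarrow> central S \<delta> (Delta_rel ar A F S \<theta>)"
proof
  assume M: "central S \<delta> (M_rel ar A F S \<theta>)"
  have "hd_tolerance ar A F S (M_rel ar A F S \<theta>)" using alg \<theta> by (rule M_rel_tolerance)
  from central_hd_congruence_above[OF alg cm \<delta> this M S]
  obtain R where R: "hd_congruence ar A F S R" "central S \<delta> R" "M_rel ar A F S \<theta> \<subseteq> R" .
  then have "Delta_rel ar A F S \<theta> \<subseteq> R" unfolding Delta_rel_def by (intro Inter_lower) simp
  with R(2) show "central S \<delta> (Delta_rel ar A F S \<theta>)" by (rule central_mono)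
next
  assume \<Delta>: "central S \<delta> (Delta_rel ar A F S \<theta>)"
  have "M_rel ar A F S \<theta> \<subseteq> Delta_rel ar A F S \<theta>"
    unfolding Delta_rel_def by (intro Inter_greatest) simp
  with \<Delta> show "central S \<delta> (M_rel ar A F S \<theta>)" by (rule central_mono)
qed

theorem theorem2p6:
  fixes ar :: "'f \<Rightarrow> nat" and A :: "'a set" and F :: "'f \<Rightarrow> 'a list \<Rightarrow> 'a"
    and n :: nat and \<theta> :: "nat \<Rightarrow> 'a rel"
  assumes "algebra ar A F"
    and "in_CM_variety ar A F"
    and "n \<ge> 2"
    and "\<forall>k<n. \<theta> k \<in> Con ar A F"
  shows "TC_comm ar A F n \<theta> = H_comm ar A F n \<theta>"
proof -
  have "central {..<n} \<delta> (M_rel ar A F {..<n} \<theta>) \<longleftrightarrow> central {..<n} \<delta> (Delta_rel ar A F {..<n} \<theta>)"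
    if "\<delta> \<in> Con ar A F" for \<delta>
  proof (rule central_M_rel_iff_central_Delta_rel[OF assms(1,2) that finite_lessThan])
    show "{..<n} \<noteq> {k}" for k
    proof
      assume "{..<n} = {k}"
      then have "card {..<n} = 1" by simp
      then show False using \<open>n \<ge> 2\<close> by simp
    qed
    show "\<theta> k \<in> Con ar A F" if "k \<in> {..<n}" for k using assms(4) that by simp
  qed
  then have "{\<delta> \<in> Con ar A F. central {..<n} \<delta> (M_rel ar A F {..<n} \<theta>)} =
      {\<delta> \<in> Con ar A F. central {..<n} \<delta> (Delta_rel ar A F {..<n} \<theta>)}"
    by (intro Collect_cong conj_cong refl)
  then show ?thesis by (simp only: TC_comm_def H_comm_def)
qed

end
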